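(* For all integers $n\geq m\geq 3$, $$R(\mathcal{C}^3_n,\mathcal{C}^3_m)=2n+\Big\lfloor\frac{m-1}{2}\Big\rfloor .$$
   Context: The 3-uniform loose cycle $\mathcal{C}^3_n$ (of length $n$) is the hypergraph with vertex set $\{v_1,\dots,v_{2n}\}$ and the $n$ edges $\{v_{2i+1},v_{2i+2},v_{2i+3}\}$, $i=0,1,\dots,n-1$, subscripts taken modulo $2n$. For 3-uniform hypergraphs $\mathcal{H},\mathcal{G}$, the Ramsey number $R(\mathcal{H},\mathcal{G})$ is the smallest $N$ such that every red-blue coloring of the edges of the complete 3-uniform hypergraph $\mathcal{K}^3_N$ on $N$ vertices contains a red copy of $\mathcal{H}$ or a blue copy of $\mathcal{G}$ (copies are not necessarily induced). *)

theory Defs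
  imports "HOL-Library.Ramsey"
begin

(* A hypergraph is a pair (V, E) of a vertex set and a set of edges; nsets V k is the
   set of all k-element subsets of V. *)
type_synonym 'a hypergraph = "'a set \<times> 'a set set"

definition uniform3 :: "'a hypergraph \<Rightarrow> bool" where
  "uniform3 H \<longleftrightarrow> finite (fst H) \<and> snd H \<subseteq> nsets (fst H) 3"

(* v_j is represented by j mod 2n, so v_{2n} is 0. This is the intended object for
   n \<ge> 3 only. *)
definition loose_cycle :: "nat \<Rightarrow> nat hypergraph" where
  "loose_cycle n =
     ({..<2 * n},
      {{(2 * i + 1) mod (2 * n), (2 * i + 2) mod (2 * n), (2 * i + 3) mod (2 * n)} | i. i < n})"

definition complete3 :: "nat \<Rightarrow> nat hypergraph" where
  "complete3 N = ({..<N}, nsets {..<N} 3)"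

(* G contains a (not necessarily induced) copy of H. *)
definition contains_copy :: "'b hypergraph \<Rightarrow> 'a hypergraph \<Rightarrow> bool" where
  "contains_copy G H \<longleftrightarrow>
     (\<exists>f. inj_on f (fst H) \<and> f ` fst H \<subseteq> fst G \<and> (\<forall>e\<in>snd H. f ` e \<in> snd G))"

datatype colour = Red | Blue

definition colour_class :: "'a hypergraph \<Rightarrow> ('a set \<Rightarrow> colour) \<Rightarrow> colour \<Rightarrow> 'a hypergraph" where
  "colour_class G \<chi> k = (fst G, {e \<in> snd G. \<chi> e = k})"

(* A colouring is a total function on sets; only its values on edges matter. *)
definition arrows3 :: "nat \<Rightarrow> 'a hypergraph \<Rightarrow> 'b hypergraph \<Rightarrow> bool" where
  "arrows3 N H G \<longleftrightarrow>
     (\<forall>\<chi>. contains_copy (colour_class (complete3 N) \<chi> Red) H \<or>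
          contains_copy (colour_class (complete3 N) \<chi> Blue) G)"

(* Meant for uniform3 hypergraphs, for which such an N exists by Ramsey's theorem. *)
definition ramsey_number3 :: "'a hypergraph \<Rightarrow> 'b hypergraph \<Rightarrow> nat" where
  "ramsey_number3 H G = (LEAST N. arrows3 N H G)"

lemma uniform3_loose_cycle:
  assumes "n \<ge> 3"
  shows "uniform3 (loose_cycle n)"
proof -
  have "{(2*i+1) mod (2*n), (2*i+2) mod (2*n), (2*i+3) mod (2*n)} \<in> nsets {..<2*n} 3"
    if "i < n" for i
  proof (cases "i = n - 1")
    case True
    have eq: "2*i+1 = 2*n - 1" "2*i+2 = 2*n" "2*i+3 = 1 + 2*n"
      using True assms by auto
    have "(2*i+1) mod (2*n) = 2*n - 1" "(2*i+2) mod (2*n) = 0" "(2*i+3) mod (2*n) = 1"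
      unfolding eq mod_add_self2 using assms by simp_all
    then show ?thesis
      using assms by (auto simp: nsets_def)
  next
    case False
    then have "2*i+3 < 2*n" using that by linarith
    then show ?thesis
      by (auto simp: nsets_def)
  qed
  then show ?thesis
    by (auto simp: uniform3_def loose_cycle_def)
qed

end

theory Submission
  imports Defs
begin

text \<open>
  Upper bound, by induction on \<open>n\<close>: a smaller case of the theorem gives a red cycle of length
  \<open>l = n - 1\<close> (swapping the colours if \<open>n = m\<close>), and the set \<open>W\<close> of the other vertices has at
  least \<open>2 + (m - 1) div 2\<close> elements. Suppose that there is no red cycle of length \<open>l + 1\<close>.
  Then no red path may replace a segment of the cycle by one more edge, which makes many triples
  blue. In particular every pair of consecutive edges of the red cycle contains a
  \<^emph>\<open>connector\<close>: three vertices through which almost any two vertices of \<open>W\<close> are joined by a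
  blue path of length two. Disjoint connectors are strung together through distinct vertices of
  \<open>W\<close>, and the resulting blue path is closed by one edge (\<open>m\<close> odd) or two edges (\<open>m\<close> even). The
  difficulty is that the \<open>l \<ge> m - 1\<close> edges of the red cycle are only just enough, so that
  connectors competing for a common joint of the red cycle must be rearranged.

  Lower bound: on fewer vertices, colour the triples inside a set of \<open>2 n - 1\<close> vertices red and all
  others blue. A vertex lies in at most two edges of a loose cycle, so the at most
  \<open>(m - 1) div 2\<close> remaining vertices do not meet all edges of a blue cycle of length \<open>m\<close>.
\<close>

section \<open>Loose paths given by vertex lists\<close>

text \<open>Joints stand at even positions. Lists of even length are rejected.\<close>

fun loose_path :: "('a set \<Rightarrow> bool) \<Rightarrow> 'a list \<Rightarrow> bool" where
  "loose_path P [x] = True"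
| "loose_path P (x # y # z # r) = (P {x, y, z} \<and> loose_path P (z # r))"
| "loose_path P _ = False"

definition closed_loose_path :: "('a set \<Rightarrow> bool) \<Rightarrow> 'a list \<Rightarrow> bool" where
  "closed_loose_path P xs \<longleftrightarrow> xs \<noteq> [] \<and> distinct xs \<and> loose_path P (xs @ [hd xs])"

lemma loose_path_append:
  "loose_path P (xs @ [z]) \<Longrightarrow> loose_path P (z # ys) \<Longrightarrow> loose_path P (xs @ z # ys)"
proof (induction xs rule: induct_list012)
  case (3 x y zs)
  then show ?case by (cases zs) auto
qed auto

lemma loose_path_nth:
  "loose_path P xs \<Longrightarrow> 2 * i + 2 < length xs \<Longrightarrow> P {xs ! (2 * i), xs ! (2 * i + 1), xs ! (2 * i + 2)}"
proof (induction P xs arbitrary: i rule: loose_path.induct)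
  case (2 P x y z r)
  then show ?case by (cases i) auto
qed auto

lemma closed_loose_path_nth:
  assumes "closed_loose_path P xs" "length xs = 2 * n" "i < n"
  shows "P {xs ! (2 * i), xs ! (2 * i + 1), xs ! ((2 * i + 2) mod (2 * n))}"
proof -
  have ne: "xs \<noteq> []" and lp: "loose_path P (xs @ [hd xs])"
    using assms by (auto simp: closed_loose_path_def)
  have *: "P {(xs @ [hd xs]) ! (2 * i), (xs @ [hd xs]) ! (2 * i + 1), (xs @ [hd xs]) ! (2 * i + 2)}"
    by (rule loose_path_nth[OF lp]) (use assms in auto)
  have "(xs @ [hd xs]) ! (2 * i + 2) = xs ! ((2 * i + 2) mod (2 * n))"
  proof (cases "i = n - 1")
    case True
    then have "2 * i + 2 = 2 * n" using assms by simp
    then show ?thesis using assms ne by (simp add: nth_append hd_conv_nth)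
  next
    case False
    then have "2 * i + 2 < 2 * n" using assms by simp
    then show ?thesis using assms by (simp add: nth_append)
  qed
  moreover have "2 * i + 1 < 2 * n" using assms by simp
  ultimately show ?thesis using * assms by (simp add: nth_append)
qed

lemma closed_loose_path_copy:
  assumes xs: "closed_loose_path P xs" "length xs = 2 * n" "set xs \<subseteq> V" and n: "n \<ge> 3"
  shows "contains_copy (V, {e \<in> nsets V 3. P e}) (loose_cycle n)"
proof -
  define f where "f j = xs ! ((j + (2 * n - 1)) mod (2 * n))" for j
  have dist: "distinct xs" using xs by (auto simp: closed_loose_path_def)
  have shift: "f ((j + 1) mod (2 * n)) = xs ! (j mod (2 * n))" for j
  proof -
    have "((j + 1) mod (2 * n) + (2 * n - 1)) mod (2 * n) = (j + 1 + (2 * n - 1)) mod (2 * n)"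
      by (simp add: mod_add_left_eq)
    also have "j + 1 + (2 * n - 1) = j + 2 * n" using n by simp
    finally show ?thesis by (simp add: f_def)
  qed
  have inj: "inj_on f {..<2 * n}"
  proof (rule inj_onI)
    fix i j assume ij: "i \<in> {..<2 * n}" "j \<in> {..<2 * n}" and eq: "f i = f j"
    have "(i + (2 * n - 1)) mod (2 * n) = (j + (2 * n - 1)) mod (2 * n)"
      using eq dist n by (simp add: f_def nth_eq_iff_index_eq xs(2))
    then have "(i + (2 * n - 1) + 1) mod (2 * n) = (j + (2 * n - 1) + 1) mod (2 * n)"
      by (metis mod_add_left_eq)
    then have "(i + 2 * n) mod (2 * n) = (j + 2 * n) mod (2 * n)" using n by simp
    then show "i = j" using ij by simp
  qed
  have sub: "f ` {..<2 * n} \<subseteq> V"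
    using xs n by (auto simp: f_def intro!: nth_mem subsetD[OF xs(3)])
  have edge: "f ` e \<in> {e \<in> nsets V 3. P e}" if e_in: "e \<in> snd (loose_cycle n)" for e
  proof -
    obtain i where i: "i < n" and e: "e = {(2 * i + 1) mod (2 * n), (2 * i + 2) mod (2 * n), (2 * i + 3) mod (2 * n)}"
      using e_in unfolding loose_cycle_def snd_conv by blast
    have "f ` e = {f ((2 * i + 1) mod (2 * n)), f ((2 * i + 1 + 1) mod (2 * n)), f ((2 * i + 2 + 1) mod (2 * n))}"
      unfolding e by (simp add: numeral_3_eq_3)
    also have "\<dots> = {xs ! (2 * i), xs ! (2 * i + 1), xs ! ((2 * i + 2) mod (2 * n))}"
      unfolding shift using i by simp
    finally have "P (f ` e)" using closed_loose_path_nth[OF xs(1,2) i] by simp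
    have e3: "e \<in> nsets {..<2 * n} 3"
      using uniform3_loose_cycle[OF n] e_in by (auto simp: uniform3_def loose_cycle_def)
    have "card (f ` e) = card e"
      by (rule card_image) (use e3 inj in \<open>auto simp: nsets_def intro: inj_on_subset\<close>)
    then show ?thesis using e3 sub \<open>P (f ` e)\<close> by (auto simp: nsets_def)
  qed
  show ?thesis
    unfolding contains_copy_def
    by (rule exI[of _ f]) (use inj sub edge in \<open>auto simp: loose_cycle_def\<close>)
qed

section \<open>Choosing distinct vertices and joining paths of length two\<close>

lemma ex_distinct_list:
  assumes "finite S" "n \<le> card S"
  obtains ws where "distinct ws" "set ws \<subseteq> S" "length ws = n"
proof -
  obtain T where "T \<subseteq> S" "card T = n" "finite T"
    using assms by (metis obtain_subset_with_card_n)
  then show ?thesis using that finite_distinct_list[of T] by (metis distinct_card)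
qed

lemma card_le_1D: "card S \<le> 1 \<Longrightarrow> finite S \<Longrightarrow> x \<in> S \<Longrightarrow> y \<in> S \<Longrightarrow> x = y"
  by (metis One_nat_def card_le_Suc0_iff_eq)

lemma ex_avoiding:
  assumes "card F < card S" "finite F"
  obtains z where "z \<in> S" "z \<notin> F"
  using assms by (metis card_mono leD subsetI)

text \<open>Greedy choice from the front: the next element has to differ from the current one and
  from the exceptions on both sides of it. These are at most three elements against at least four in
  \<open>S\<close>, or two against three at the end.\<close>

lemma ex_sequence_avoiding:
  assumes "card S \<ge> length xs + 2" "finite S" "w \<in> S" "xs \<noteq> [] \<Longrightarrow> w \<noteq> hd xs"
  shows "\<exists>ws. distinct ws \<and> set ws \<subseteq> S \<and> length ws = length xs + 1 \<and> hd ws = w \<and>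
    (\<forall>i<length xs. ws ! i \<noteq> xs ! i \<and> ws ! Suc i \<noteq> xs ! i)"
  using assms
proof (induction xs arbitrary: w S)
  case Nil
  then show ?case by (intro exI[of _ "[w]"]) auto
next
  case (Cons x xs)
  obtain w' where w': "w' \<in> S" "w' \<notin> {w, x} \<union> set (take 1 xs)"
  proof (rule ex_avoiding)
    have "card ({w, x} \<union> set (take 1 xs)) \<le> card {w, x} + card (set (take 1 xs))" by (rule card_Un_le)
    also have "card (set (take 1 xs)) \<le> length (take 1 xs)" by (rule card_length)
    also have "card {w, x} \<le> 2" by (simp add: card_insert_if)
    finally show "card ({w, x} \<union> set (take 1 xs)) < card S" using Cons.prems(1) by (cases xs) auto
  qed auto
  have "\<exists>ws. distinct ws \<and> set ws \<subseteq> S - {w} \<and> length ws = length xs + 1 \<and> hd ws = w' \<and>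
    (\<forall>i<length xs. ws ! i \<noteq> xs ! i \<and> ws ! Suc i \<noteq> xs ! i)"
    by (rule Cons.IH) (use Cons.prems w' in \<open>auto simp: hd_conv_nth take_Suc\<close>)
  then obtain ws where ws: "distinct ws" "set ws \<subseteq> S - {w}" "length ws = length xs + 1" "hd ws = w'"
    "\<forall>i<length xs. ws ! i \<noteq> xs ! i \<and> ws ! Suc i \<noteq> xs ! i" by blast
  have "ws ! 0 = w'" using ws by (metis One_nat_def add_is_0 hd_conv_nth list.size(3) nat.simps(3))
  then have "\<forall>i<length (x # xs). (w # ws) ! i \<noteq> (x # xs) ! i \<and> (w # ws) ! Suc i \<noteq> (x # xs) ! i"
    using ws(5) w' Cons.prems(4) by (auto simp: less_Suc_eq_0_disj)
  then show ?case
    using ws Cons.prems(3) by (intro exI[of _ "w # ws"]) auto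
qed

text \<open>A loose path of length two. That its ends are distinct and lie outside \<open>T\<close>
  is ensured where such paths are joined.\<close>

definition two_link :: "('a set \<Rightarrow> bool) \<Rightarrow> 'a set \<Rightarrow> 'a \<Rightarrow> 'a \<Rightarrow> bool" where
  "two_link P T u w \<longleftrightarrow> (\<exists>p q r. {p, q, r} \<subseteq> T \<and> distinct [p, q, r] \<and> P {u, p, q} \<and> P {q, r, w})"

lemma two_link_chain:
  assumes "length ws = Suc (length Ts)" "distinct ws" "set ws \<inter> \<Union>(set Ts) = {}"
    "sorted_wrt (\<lambda>A B. A \<inter> B = {}) Ts" "\<forall>i<length Ts. two_link P (Ts ! i) (ws ! i) (ws ! Suc i)"
  shows "\<exists>ps. loose_path P ps \<and> hd ps = hd ws \<and> last ps = last ws \<and> length ps = 4 * length Ts + 1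
    \<and> distinct ps \<and> set ps \<subseteq> set ws \<union> \<Union>(set Ts)"
  using assms
proof (induction Ts arbitrary: ws)
  case Nil
  then obtain w where "ws = [w]" by (metis length_0_conv length_Suc_conv list.size(3))
  then show ?case by (intro exI[of _ "[w]"]) auto
next
  case (Cons T Ts)
  obtain w ws' where ws: "ws = w # ws'" and len: "length ws' = Suc (length Ts)"
    using Cons.prems(1) by (auto simp: length_Suc_conv)
  then have "ws' \<noteq> []" by auto
  note ws = ws this
  have "\<exists>ps. loose_path P ps \<and> hd ps = hd ws' \<and> last ps = last ws' \<and> length ps = 4 * length Ts + 1
    \<and> distinct ps \<and> set ps \<subseteq> set ws' \<union> \<Union>(set Ts)"
    by (rule Cons.IH) (use Cons.prems ws in auto)
  then obtain ps where ps: "loose_path P ps" "hd ps = hd ws'" "last ps = last ws'" "length ps = 4 * length Ts + 1"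
    "distinct ps" "set ps \<subseteq> set ws' \<union> \<Union>(set Ts)" by blast
  then obtain ps' where ps': "ps = hd ws' # ps'" by (metis add_is_0 list.exhaust_sel list.size(3) one_neq_zero)
  have "two_link P T w (hd ws')" using Cons.prems(5) ws by (auto simp: hd_conv_nth)
  then obtain p q r where pqr: "{p, q, r} \<subseteq> T" "distinct [p, q, r]" "P {w, p, q}" "P {q, r, hd ws'}"
    by (auto simp: two_link_def)
  have disj: "T \<inter> \<Union>(set Ts) = {}" "T \<inter> set ws = {}" using Cons.prems by auto
  show ?case
  proof (intro exI[of _ "w # p # q # r # ps"] conjI)
    show "loose_path P (w # p # q # r # ps)" using pqr ps ps' by simp
    show "last (w # p # q # r # ps) = last ws" using ps ps' ws by simp
    have "T \<inter> set ps = {}" using disj ps(6) ws by fastforce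
    moreover have "w \<notin> T" "w \<notin> set ps" using disj ps(6) ws Cons.prems(2,3) by auto
    ultimately have "set ps \<inter> {w, p, q, r} = {}" "w \<notin> {p, q, r}"
      using pqr(1) by auto
    then show "distinct (w # p # q # r # ps)" using pqr(2) ps(5) by auto
    show "set (w # p # q # r # ps) \<subseteq> set ws \<union> \<Union>(set (T # Ts))" using pqr ps ws by auto
  qed (use ps ws in auto)
qed

section \<open>A red cycle that cannot be lengthened\<close>

text \<open>The cycle is indexed by the integers with period \<open>2 * l\<close>, so that shifts and the reversal
  \<open>\<lambda>i. v (- i)\<close> are again instances of the locale: joints have even and inner vertices odd index.\<close>

locale red_cycle =
  fixes red :: "'a set \<Rightarrow> bool" and v :: "int \<Rightarrow> 'a" and l :: nat and W :: "'a set"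
  assumes len2: "l \<ge> 2"
    and v_eq_iff: "v i = v j \<longleftrightarrow> 2 * int l dvd i - j"
    and v_notin: "v i \<notin> W"
    and finite_W: "finite W"
    and red_edge: "red {v (2 * i), v (2 * i + 1), v (2 * i + 2)}"
    and no_longer: "\<not> (closed_loose_path red xs \<and> length xs = 2 * (l + 1) \<and> set xs \<subseteq> range v \<union> W)"
begin

abbreviation "blue e \<equiv> \<not> red e"

lemma v_neq:
  assumes "i \<noteq> j" "\<bar>i - j\<bar> < 2 * int l"
  shows "v i \<noteq> v j"
  using assms dvd_imp_le_int[of "i - j" "2 * int l"] by (auto simp: v_eq_iff)

lemma v_periodic [simp]: "v (i + 2 * int l) = v i"
  by (simp add: v_eq_iff)

lemma inj_on_v: "inj_on v {i..<i + 2 * int l}"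
proof (rule inj_onI, rule ccontr)
  fix j k assume jk: "j \<in> {i..<i + 2 * int l}" "k \<in> {i..<i + 2 * int l}" "v j = v k" "j \<noteq> k"
  then have "\<bar>j - k\<bar> < 2 * int l" by auto
  then show False using v_neq jk by blast
qed

lemma loose_path_arc: "loose_path red (map v [2 * i..2 * i + 2 * int n])"
proof (induction n arbitrary: i)
  case (Suc n)
  have rec: "[j..k + 2] = j # (j + 1) # [j + 2..k + 2]" if "j \<le> k" for j k :: int
    using that by (simp add: upto_rec1)
  have "[2 * i..2 * i + 2 * int n + 2] = 2 * i # (2 * i + 1) # [2 * i + 2..2 * i + 2 * int n + 2]"
    by (rule rec) simp
  moreover have "[2 * i + 2..2 * i + 2 * int n + 2] = (2 * i + 2) # [2 * i + 2 + 1..2 * i + 2 * int n + 2]"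
    by (rule upto_rec1) simp
  moreover have "2 * (i + 1) = 2 * i + 2" "2 * (i + 1) + 2 * int n = 2 * i + 2 * int n + 2"
    "2 * i + 2 * int (Suc n) = 2 * i + 2 * int n + 2" by simp_all
  ultimately show ?case using Suc[of "i + 1"] red_edge[of i]
    by (simp only: list.map loose_path.simps simp_thms)
qed simp

text \<open>Replacing \<open>s\<close> edges of the cycle by the \<open>s + 1\<close> edges of the
  path would give a red cycle of length \<open>l + 1\<close>. For \<open>s = l\<close> the two ends
  coincide and the whole cycle is replaced.\<close>

lemma no_detour:
  assumes path: "loose_path red (v (2 * i) # ps @ [v (2 * i + 2 * int s)])"
    and s0: "s > 0" and s: "s \<le> l" and ps: "length ps = 2 * s + 1" "distinct ps" "set ps \<subseteq> W \<union> v ` {2 * i<..<2 * i + 2 * int s}"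
  shows False
proof -
  \<comment> \<open>The part of the cycle that is kept, without its final joint
    \<open>v (2 * i + 2 * int l) = v (2 * i)\<close>; it is empty for \<open>s = l\<close>.\<close>
  define arc where "arc = map v [2 * i + 2 * int s..2 * i + 2 * int l - 1]"
  have "[2 * i + 2 * int s..2 * i + 2 * int l] = [2 * i + 2 * int s..2 * i + 2 * int l - 1] @ [2 * i + 2 * int l]"
    using s by (simp add: upto_rec2)
  then have arc: "arc @ [v (2 * i)] = map v [2 * i + 2 * int s..2 * i + 2 * int l]"
    by (simp add: arc_def)
  have "2 * i + 2 * int s = 2 * (i + int s)" "2 * i + 2 * int l = 2 * (i + int s) + 2 * int (l - s)"
    using s by auto
  then have arc_path: "loose_path red (arc @ [v (2 * i)])"
    unfolding arc by (simp only: loose_path_arc)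
  define rest where "rest = map v [2 * i + 2 * int s + 1..2 * i + 2 * int l]"
  have rest: "arc @ [v (2 * i)] = v (2 * i + 2 * int s) # rest"
    unfolding arc rest_def using s by (simp add: upto_rec1)
  have "loose_path red ((v (2 * i) # ps) @ v (2 * i + 2 * int s) # rest)"
  proof (rule loose_path_append)
    show "loose_path red ((v (2 * i) # ps) @ [v (2 * i + 2 * int s)])" using path by simp
    show "loose_path red (v (2 * i + 2 * int s) # rest)" using arc_path rest by simp
  qed
  then have "loose_path red ((v (2 * i) # ps @ arc) @ [hd (v (2 * i) # ps @ arc)])"
    using rest by simp
  moreover have "distinct (v (2 * i) # ps @ arc)"
  proof -
    let ?I = "{2 * i..<2 * i + 2 * int l}"
    have inj: "v j \<noteq> v k" if "j \<in> ?I" "k \<in> ?I" "j \<noteq> k" for j k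
      using inj_on_v[of "2 * i"] that by (auto dest: inj_onD)
    have set_arc: "set arc = v ` {2 * i + 2 * int s..2 * i + 2 * int l - 1}" by (simp add: arc_def)
    have notin_arc: "v j \<notin> set arc" if "j \<in> {2 * i..<2 * i + 2 * int s}" for j
    proof
      assume "v j \<in> set arc"
      then obtain k where k: "k \<in> {2 * i + 2 * int s..2 * i + 2 * int l - 1}" "v j = v k"
        unfolding set_arc by blast
      then show False using inj[of j k] that s by auto
    qed
    have "distinct arc"
      using s by (auto simp: arc_def distinct_map intro: inj_on_subset[OF inj_on_v[of "2 * i"]])
    moreover have "x \<notin> set arc \<and> x \<noteq> v (2 * i)" if "x \<in> set ps" for x
    proof (cases "x \<in> W")
      case True
      then show ?thesis using v_notin by (auto simp: arc_def)
    next
      case False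
      then obtain j where j: "x = v j" "j \<in> {2 * i<..<2 * i + 2 * int s}" using ps(3) \<open>x \<in> set ps\<close> by auto
      have "v j \<notin> set arc" by (rule notin_arc) (use j in auto)
      moreover have "v j \<noteq> v (2 * i)" by (rule inj) (use j s in auto)
      ultimately show ?thesis using j(1) by simp
    qed
    then have "set ps \<inter> set arc = {}" "v (2 * i) \<notin> set ps" by auto
    moreover have "v (2 * i) \<notin> set arc" using s0 by (intro notin_arc) auto
    ultimately show ?thesis using ps(2) by auto
  qed
  moreover have "length (v (2 * i) # ps @ arc) = 2 * (l + 1)"
    using s ps by (simp add: arc_def)
  moreover have "set (v (2 * i) # ps @ arc) \<subseteq> range v \<union> W"
    using ps by (auto simp: arc_def)
  ultimately show False
    using no_longer[of "v (2 * i) # ps @ arc"] unfolding closed_loose_path_def by blast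
qed

lemma reverse: "red_cycle red (\<lambda>i. v (- i)) l W"
proof
  show "v (- i) = v (- j) \<longleftrightarrow> 2 * int l dvd i - j" for i j
    by (simp add: v_eq_iff) (metis dvd_minus_iff minus_diff_eq)
  show "red {v (- (2 * i)), v (- (2 * i + 1)), v (- (2 * i + 2))}" for i
  proof -
    \<comment> \<open>The reversed edge \<open>i\<close> is the original edge
      \<open>- i - 1\<close>.\<close>
    have "2 * (- i - 1) = - (2 * i + 2)" "2 * (- i - 1) + 1 = - (2 * i + 1)" "2 * (- i - 1) + 2 = - (2 * i)" by auto
    then show ?thesis using red_edge[of "- i - 1"] by (simp only: insert_commute)
  qed
  show "\<not> (closed_loose_path red xs \<and> length xs = 2 * (l + 1) \<and> set xs \<subseteq> range (\<lambda>i. v (- i)) \<union> W)" for xs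
    using no_longer[of xs] by auto
qed (use len2 v_notin finite_W in auto)


lemma detour1:
  assumes "{p, q, r} \<subseteq> W \<union> {v (2 * i + 1)}" "distinct [p, q, r]"
    "red {v (2 * i), p, q}" "red {q, r, v (2 * i + 2)}"
  shows False
proof -
  have "{2 * i<..<2 * i + 2} = {2 * i + 1}" by auto
  then show False
    by (intro no_detour[of i "[p, q, r]" 1]) (use assms len2 in simp_all)
qed

lemma detour2:
  assumes "{p1, p2, p3, p4, p5} \<subseteq> W \<union> {v (2 * i + 1), v (2 * i + 2), v (2 * i + 3)}"
    "distinct [p1, p2, p3, p4, p5]"
    "red {v (2 * i), p1, p2}" "red {p2, p3, p4}" "red {p4, p5, v (2 * i + 4)}"
  shows False
proof -
  have "{2 * i<..<2 * i + 4} = {2 * i + 1, 2 * i + 2, 2 * i + 3}" by auto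
  then show False
    by (intro no_detour[of i "[p1, p2, p3, p4, p5]" 2]) (use assms len2 in simp_all)
qed

lemma detour4:
  assumes "l \<ge> 4" "{p1, p2, p3, p4, p5, p6, p7, p8, p9} \<subseteq> W \<union> v ` {2 * i<..<2 * i + 8}"
    "distinct [p1, p2, p3, p4, p5, p6, p7, p8, p9]"
    "red {v (2 * i), p1, p2}" "red {p2, p3, p4}" "red {p4, p5, p6}" "red {p6, p7, p8}" "red {p8, p9, v (2 * i + 8)}"
  shows False
  by (rule no_detour[of i "[p1, p2, p3, p4, p5, p6, p7, p8, p9]" 4]) (use assms in simp_all)

section \<open>Blue links and their exceptional vertices\<close>

definition reds :: "'a \<Rightarrow> 'a \<Rightarrow> 'a set" where
  "reds p q = {x \<in> W. red {p, q, x}}"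

lemma finite_reds [simp]: "finite (reds p q)"
  using finite_W by (simp add: reds_def)

lemma reds_commute: "reds p q = reds q p"
  by (simp add: reds_def insert_commute)

text \<open>Recording index sets instead of vertex sets makes disjointness of connectors a matter of
  integer arithmetic.\<close>

definition link :: "int set \<Rightarrow> 'a \<Rightarrow> 'a \<Rightarrow> bool" where
  "link I = two_link (\<lambda>e. blue e) (v ` I)"

lemma linkI:
  assumes "{i, j, k} \<subseteq> I" "distinct [v i, v j, v k]" "u \<in> W" "w \<in> W"
    "u \<notin> reds (v i) (v j)" "w \<notin> reds (v j) (v k)"
  shows "link I u w" "link I w u"
proof -
  have *: "blue {u, v i, v j}" "blue {v j, v k, w}" "blue {w, v k, v j}" "blue {v j, v i, u}"
    using assms by (simp_all add: reds_def insert_commute)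
  show "link I u w"
    unfolding link_def two_link_def 
    by (rule exI[of _ "v i"], rule exI[of _ "v j"], rule exI[of _ "v k"]) (use assms * in auto)
  show "link I w u"
    unfolding link_def two_link_def 
    by (rule exI[of _ "v k"], rule exI[of _ "v j"], rule exI[of _ "v i"]) (use assms * in auto)
qed

text \<open>The exception \<open>x\<close> need not belong to \<open>W\<close>.\<close>

definition connector :: "int set \<Rightarrow> 'a \<Rightarrow> bool" where
  "connector I x \<longleftrightarrow> (\<forall>u\<in>W - {x}. \<forall>w\<in>W - {x}. u \<noteq> w \<longrightarrow> link I u w)"

text \<open>The exception is a common element of the two red sets or else, if possible, any element
  of the first. Of the other vertices, none lies in both sets and neither set contains two, so for
  all \<open>u\<close> and \<open>w\<close> one of the two directions of the path is blue.\<close>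

lemma ex_connector:
  assumes I: "{i, j, k} \<subseteq> I" "distinct [v i, v j, v k]"
    and X: "card (reds (v i) (v j)) \<le> 2" and Y: "card (reds (v j) (v k)) \<le> 1"
  shows "\<exists>x. connector I x"
proof -
  define X Y where "X = reds (v i) (v j)" and "Y = reds (v j) (v k)"
  have fin: "finite X" "finite Y" by (simp_all add: X_def Y_def)
  have Y1: "y = y'" if "y \<in> Y" "y' \<in> Y" for y y'
    using card_le_1D[OF _ fin(2) that] Y by (simp add: Y_def)
  have "\<exists>x. (Y \<inter> X = {} \<or> x \<in> Y \<inter> X) \<and> (X = {} \<or> x \<in> X)" by blast
  then obtain x where xYX: "Y \<inter> X = {} \<or> x \<in> Y \<inter> X" and xX: "X = {} \<or> x \<in> X" by blast
  have X1: "u = w" if "u \<in> X - {x}" "w \<in> X - {x}" for u w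
  proof -
    have "x \<in> X" using xX that by auto
    then have "card (X - {x}) \<le> 1" using X by (simp add: X_def)
    then show ?thesis using card_le_1D[OF _ _ that] fin by simp
  qed
  have "link I u w" if uw: "u \<in> W - {x}" "w \<in> W - {x}" "u \<noteq> w" for u w
  proof (cases "u \<notin> X \<and> w \<notin> Y")
    case True
    then show ?thesis using uw by (intro linkI(1)[OF I]) (simp_all add: X_def Y_def)
  next
    case False
    have "\<not> (z \<in> X \<and> z \<in> Y)" if "z \<noteq> x" for z
      using xYX Y1[of z x] that by fast
    then have "\<not> (w \<in> X \<and> w \<in> Y)" "\<not> (u \<in> X \<and> u \<in> Y)" using uw by auto
    then have "w \<notin> X" "u \<notin> Y"
      using False X1[of u w] Y1[of u w] uw by fast+
    then show ?thesis using uw by (intro linkI(2)[OF I]) (simp_all add: X_def Y_def)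
  qed
  then show ?thesis unfolding connector_def by blast
qed

lemma v_neq4: "i \<noteq> j \<Longrightarrow> \<bar>i - j\<bar> < 4 \<Longrightarrow> v i \<noteq> v j"
  using len2 by (intro v_neq) auto

lemma v_neq_W: "x \<in> W \<Longrightarrow> x \<noteq> v i" "x \<in> W \<Longrightarrow> v i \<noteq> x"
  using v_notin by auto

lemma reds_W: "x \<in> reds p q \<Longrightarrow> x \<in> W"
  by (simp add: reds_def)

lemma reds_D: "x \<in> reds p q \<Longrightarrow> red {p, x, q} \<and> red {p, q, x} \<and> red {q, x, p} \<and> red {x, p, q}"
  by (simp add: reds_def insert_commute)

text \<open>Otherwise \<open>{v (2 * i), x, v (2 * i + 1)}\<close> and
  \<open>{v (2 * i + 1), y, v (2 * i + 2)}\<close> would replace the edge \<open>i\<close> by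
  two.\<close>

lemma reds_crossing:
  assumes "x \<in> reds (v (2 * i)) (v (2 * i + 1))" "y \<in> reds (v (2 * i + 1)) (v (2 * i + 2))"
  shows "x = y"
proof (rule ccontr)
  assume "x \<noteq> y"
  then show False
    using assms by (intro detour1[of x "v (2 * i + 1)" y i]) (auto simp: v_neq_W reds_W dest: reds_D)
qed

text \<open>If red, this triple and the red \<open>{y, v (2 * i + 1), v (2 * i + 2)}\<close> would
  replace the edge \<open>i\<close> by two. Such blue triples at a joint are used to close
  chains.\<close>

lemma blue_witness:
  assumes "y \<in> reds (v (2 * i + 1)) (v (2 * i + 2))" "z \<in> W" "z \<noteq> y"
  shows "blue {v (2 * i), y, z}"
proof
  assume "red {v (2 * i), y, z}"
  then have "red {v (2 * i), z, y}" by (simp add: insert_commute)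
  then show False
    using assms by (intro detour1[of z y "v (2 * i + 1)" i]) (auto simp: v_neq_W reds_W dest: reds_D)
qed

section \<open>Connectors in two consecutive edges\<close>

text \<open>Edge \<open>i\<close> is \<open>{v (2 * i), v (2 * i + 1), v (2 * i + 2)}\<close>. If it is right red, its left pair is blue with all
  of \<open>W\<close>, and vice versa. An edge that is neither has both pairs blue with all of \<open>W\<close> up to one
  common exception. For edges \<open>i, i + 1\<close> on \<open>a, b, c, d, e\<close>, linked means that \<open>{b, c, d}\<close> is a
  connector; otherwise \<open>{a, b, c, d}\<close> contains one unless the pair is stuck, and then
  \<open>{b, c, d, e}\<close> does.\<close>

definition right_red :: "int \<Rightarrow> bool" where
  "right_red i \<longleftrightarrow> 2 \<le> card (reds (v (2 * i + 1)) (v (2 * i + 2)))"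

definition left_red :: "int \<Rightarrow> bool" where
  "left_red i \<longleftrightarrow> 2 \<le> card (reds (v (2 * i)) (v (2 * i + 1)))"

definition linked :: "int \<Rightarrow> bool" where
  "linked i \<longleftrightarrow> right_red (i + 1) \<or> left_red i \<or> (\<not> right_red i \<and> \<not> left_red (i + 1))"

text \<open>The two cardinalities are what keeps \<open>ex_connector\<close> from applying to
  \<open>d, a, b\<close> and to \<open>d, b, a\<close>, although \<open>{a, b}\<close> is blue with
  all of \<open>W\<close>.\<close>

definition stuck :: "int \<Rightarrow> bool" where
  "stuck i \<longleftrightarrow> right_red i \<and> \<not> right_red (i + 1) \<and>
    3 \<le> card (reds (v (2 * i)) (v (2 * i + 3))) \<and> 3 \<le> card (reds (v (2 * i + 1)) (v (2 * i + 3)))"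

lemma reds_avoiding:
  assumes "card (reds p q) \<ge> 2"
  obtains y where "y \<in> reds p q" "y \<noteq> x"
  using ex_avoiding[of "{x}" "reds p q"] assms by auto

lemma reds_avoiding2:
  assumes "card (reds p q) \<ge> 3"
  obtains y where "y \<in> reds p q" "y \<noteq> x" "y \<noteq> x'"
proof -
  have "card {x, x'} < card (reds p q)" using assms by (auto simp: card_insert_if)
  then show ?thesis using that ex_avoiding[of "{x, x'}" "reds p q"] by auto
qed

lemma right_redD: "right_red i \<Longrightarrow> reds (v (2 * i)) (v (2 * i + 1)) = {}"
  by (metis equals0I reds_avoiding reds_crossing right_red_def)

lemma not_right_red: "right_red i \<Longrightarrow> \<not> left_red i"
  using right_redD[of i] by (auto simp: left_red_def)

lemma right_red_periodic [simp]: "right_red (i + int l) = right_red i"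
  unfolding right_red_def using v_periodic[of "2 * i + 1"] v_periodic[of "2 * i + 2"] by (simp add: algebra_simps)

lemma reverse_right_red: "red_cycle.right_red red (\<lambda>i. v (- i)) W i \<longleftrightarrow> left_red (- i - 1)"
proof -
  interpret rev: red_cycle red "\<lambda>i. v (- i)" l W by (rule reverse)
  have eq: "- (2 * i + 1) = 2 * (- i - 1) + 1" "- (2 * i + 2) = 2 * (- i - 1)" by auto
  show ?thesis unfolding rev.right_red_def left_red_def eq
    by (simp only: reds_commute)
qed

lemma reverse_left_red: "red_cycle.left_red red (\<lambda>i. v (- i)) W i \<longleftrightarrow> right_red (- i - 1)"
proof -
  interpret rev: red_cycle red "\<lambda>i. v (- i)" l W by (rule reverse)
  have eq: "- (2 * i + 1) = 2 * (- i - 1) + 1" "- (2 * i) = 2 * (- i - 1) + 2" by auto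
  show ?thesis unfolding rev.left_red_def right_red_def eq
    by (simp only: reds_commute)
qed

lemma reverse_linked: "red_cycle.linked red (\<lambda>i. v (- i)) W i \<longleftrightarrow> linked (- i - 2)"
proof -
  interpret rev: red_cycle red "\<lambda>i. v (- i)" l W by (rule reverse)
  have eq: "- (i + 1) - 1 = - i - 2" "- i - 2 + 1 = - i - 1" by auto
  show ?thesis unfolding rev.linked_def linked_def reverse_right_red reverse_left_red eq by auto
qed

lemma reverse_link: "red_cycle.link red (\<lambda>i. v (- i)) I u w \<longleftrightarrow> link (uminus ` I) u w"
proof -
  interpret rev: red_cycle red "\<lambda>i. v (- i)" l W by (rule reverse)
  show ?thesis by (simp add: rev.link_def link_def image_image)
qed

lemma reverse_connector: "red_cycle.connector red (\<lambda>i. v (- i)) W I x \<longleftrightarrow> connector (uminus ` I) x"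
proof -
  interpret rev: red_cycle red "\<lambda>i. v (- i)" l W by (rule reverse)
  show ?thesis by (simp add: rev.connector_def connector_def reverse_link)
qed

text \<open>On the path \<open>u, b, d, c, w\<close> the second edge is blue because edge
  \<open>i + 1\<close> is right red. If \<open>{b, d, x}\<close> were red, then
  \<open>{a, c, b}\<close>, \<open>{b, x, d}\<close>, \<open>{d, y, e}\<close> would replace two
  edges by three.\<close>

lemma link_right_red:
  assumes "right_red (i + 1)" "u \<in> W" "w \<in> W"
  shows "link {2 * i + 1..2 * i + 3} u w"
proof -
  have e: "2 * (i + 1) = 2 * i + 2" "2 * i + 2 + 1 = 2 * i + 3" "2 * i + 2 + 2 = 2 * i + 4" by auto
  have 1: "reds (v (2 * i + 3)) (v (2 * i + 2)) = {}"
    using right_redD[OF assms(1)] unfolding e by (subst reds_commute)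
  have 2: "x \<notin> reds (v (2 * i + 1)) (v (2 * i + 3))" for x
  proof
    assume x: "x \<in> reds (v (2 * i + 1)) (v (2 * i + 3))"
    obtain y where y: "y \<in> reds (v (2 * i + 3)) (v (2 * i + 4))" "y \<noteq> x"
      using assms(1) reds_avoiding unfolding right_red_def e by blast
    have "red {v (2 * i), v (2 * i + 2), v (2 * i + 1)}" using red_edge[of i] by (simp add: insert_commute)
    then show False
      using x y reds_W[OF x] reds_W[OF y(1)] reds_D[OF x] reds_D[OF y(1)]
      by (intro detour2[of "v (2 * i + 2)" "v (2 * i + 1)" x "v (2 * i + 3)" y i])
        (auto simp: v_neq_W v_neq4)
  qed
  show ?thesis
    by (rule linkI[of "2 * i + 1" "2 * i + 3" "2 * i + 2"]) (use assms 1 2 in \<open>auto simp: v_neq4\<close>)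
qed

lemma link_left_red:
  assumes "left_red i" "u \<in> W" "w \<in> W"
  shows "link {2 * i + 1..2 * i + 3} u w"
proof -
  interpret rev: red_cycle red "\<lambda>i. v (- i)" l W by (rule reverse)
  have "rev.right_red ((- i - 2) + 1)" using assms by (simp add: reverse_right_red)
  from rev.link_right_red[OF this assms(2,3)]
  have "link (uminus ` {2 * (- i - 2) + 1..2 * (- i - 2) + 3}) u w" by (simp add: reverse_link)
  moreover have "uminus ` {2 * (- i - 2) + 1..2 * (- i - 2) + 3} = {2 * i + 1..2 * i + 3}" by simp
  ultimately show ?thesis by simp
qed

lemma connector_linked:
  assumes "linked i"
  obtains x where "connector {2 * i + 1..2 * i + 3} x"
proof (cases "right_red (i + 1) \<or> left_red i")
  case True
  then show ?thesis using that link_right_red link_left_red unfolding connector_def by blast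
next
  case False
  then have "\<not> right_red i" "\<not> left_red (i + 1)" using assms by (auto simp: linked_def)
  moreover have e: "2 * (i + 1) = 2 * i + 2" "2 * i + 2 + 1 = 2 * i + 3" by auto
  ultimately have "card (reds (v (2 * i + 1)) (v (2 * i + 2))) \<le> 2" "card (reds (v (2 * i + 2)) (v (2 * i + 3))) \<le> 1"
    unfolding right_red_def left_red_def e by auto
  then show ?thesis
    using that ex_connector[of "2 * i + 1" "2 * i + 2" "2 * i + 3" "{2 * i + 1..2 * i + 3}"] by (auto simp: v_neq4)
qed

lemma stuck_not_linked: "stuck i \<Longrightarrow> \<not> linked i"
  using not_right_red by (auto simp: stuck_def linked_def)

text \<open>If edge \<open>i\<close> is right red, \<open>{a, b}\<close> is blue with all of
  \<open>W\<close>, and the path is \<open>d, a, b\<close> or \<open>d, b, a\<close>. Otherwise both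
  pairs of edge \<open>i\<close> have at most one red extension, and the path is
  \<open>a, b, c\<close>.\<close>

lemma connector_not_linked:
  assumes "\<not> linked i" "\<not> stuck i"
  obtains x where "connector {2 * i..2 * i + 3} x"
proof -
  note c = ex_connector[of _ _ _ "{2 * i..2 * i + 3}"]
  have nl: "\<not> left_red i" "\<not> right_red (i + 1)" using assms by (auto simp: linked_def)
  show ?thesis
  proof (cases "right_red i")
    case True
    then have 0: "reds (v (2 * i)) (v (2 * i + 1)) = {}" "reds (v (2 * i + 1)) (v (2 * i)) = {}"
      using right_redD by (auto simp: reds_commute)
    have "card (reds (v (2 * i)) (v (2 * i + 3))) \<le> 2 \<or> card (reds (v (2 * i + 1)) (v (2 * i + 3))) \<le> 2"
      using assms nl True by (auto simp: stuck_def)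
    then show ?thesis
      using that c[of "2 * i + 3" "2 * i" "2 * i + 1"] c[of "2 * i + 3" "2 * i + 1" "2 * i"] 0
      by (auto simp: v_neq4 reds_commute[of "v (2 * i + 3)"])
  next
    case False
    then show ?thesis
      using that c[of "2 * i" "2 * i + 1" "2 * i + 2"] nl by (auto simp: v_neq4 right_red_def left_red_def)
  qed
qed

text \<open>For \<open>w\<close> in this set the path \<open>a, z, d, z', b, w, e\<close> would be a
  red detour. The bound three in \<open>stuck\<close> leaves room to choose \<open>z\<close> and
  \<open>z'\<close> apart from \<open>w\<close> and from each other.\<close>

lemma stuckD:
  assumes "stuck i"
  shows "reds (v (2 * i + 1)) (v (2 * i + 4)) = {}"
proof -
  have "w \<notin> reds (v (2 * i + 1)) (v (2 * i + 4))" for w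
  proof
    assume w: "w \<in> reds (v (2 * i + 1)) (v (2 * i + 4))"
    obtain z where z: "z \<in> reds (v (2 * i)) (v (2 * i + 3))" "z \<noteq> w"
      using assms reds_avoiding2 unfolding stuck_def by metis
    obtain z' where z': "z' \<in> reds (v (2 * i + 1)) (v (2 * i + 3))" "z' \<noteq> w" "z' \<noteq> z"
      using assms reds_avoiding2 unfolding stuck_def by metis
    show False
      using w z z' reds_W[OF z(1)] reds_W[OF z'(1)] reds_W[OF w] reds_D[OF z(1)] reds_D[OF z'(1)] reds_D[OF w]
      by (intro detour2[of z "v (2 * i + 3)" z' "v (2 * i + 1)" w i]) (auto simp: v_neq_W v_neq4)
  qed
  then show ?thesis by blast
qed

text \<open>The path is \<open>b, e, d\<close>: \<open>{b, e}\<close> is blue with all of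
  \<open>W\<close> by \<open>stuckD\<close>, and \<open>{e, d}\<close> up to one vertex as edge
  \<open>i + 1\<close> is not right red.\<close>

lemma connector_stuck:
  assumes "stuck i"
  obtains x where "connector {2 * i + 1..2 * i + 4} x"
proof -
  note stuckD[OF assms]
  moreover have e: "2 * (i + 1) + 1 = 2 * i + 3" "2 * (i + 1) + 2 = 2 * i + 4" by auto
  have "card (reds (v (2 * i + 4)) (v (2 * i + 3))) \<le> 1"
    using assms unfolding stuck_def right_red_def e by (simp add: reds_commute)
  ultimately show ?thesis
    using that ex_connector[of "2 * i + 1" "2 * i + 4" "2 * i + 3" "{2 * i + 1..2 * i + 4}"] by (auto simp: v_neq4)
qed

text \<open>Edge \<open>i + 1\<close> is not right red and edge \<open>i + 2\<close> not left red,
  so the pair at \<open>i + 1\<close> is linked, which gives the first connector. The second is the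
  path \<open>v (2 * i + 7), v (2 * i + 1), v (2 * i)\<close>.\<close>

lemma connector_stuck_pair:
  assumes "stuck i" "\<not> linked (i + 2)" "l \<ge> 4"
  obtains x y where "connector {2 * i + 3..2 * i + 5} x" "connector {2 * i, 2 * i + 1, 2 * i + 7} y"
proof -
  have e: "i + 1 + 1 = i + 2" "2 * (i + 1) = 2 * i + 2" "2 * i + 2 + 1 = 2 * i + 3" "2 * i + 2 + 2 = 2 * i + 4"
    "2 * i + 2 + 3 = 2 * i + 5" "2 * (i + 3) = 2 * i + 6" "2 * i + 6 + 1 = 2 * i + 7" "2 * i + 6 + 2 = 2 * i + 8" by auto
  have "linked (i + 1)" using assms by (auto simp: linked_def stuck_def e)
  from connector_linked[OF this] obtain x where "connector {2 * i + 3..2 * i + 5} x"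
    unfolding e by blast
  moreover have "w \<notin> reds (v (2 * i + 1)) (v (2 * i + 7))" for w
  proof
    assume w: "w \<in> reds (v (2 * i + 1)) (v (2 * i + 7))"
    obtain y where y: "y \<in> reds (v (2 * i + 1)) (v (2 * i + 2))" "y \<noteq> w"
      using assms reds_avoiding unfolding stuck_def right_red_def by metis
    obtain z where z: "z \<in> reds (v (2 * i)) (v (2 * i + 3))" "z \<noteq> w" "z \<noteq> y"
      using assms reds_avoiding2 unfolding stuck_def by metis
    have r: "red {v (2 * i + 3), v (2 * i + 4), v (2 * i + 2)}" "red {v (2 * i + 7), v (2 * i + 6), v (2 * i + 8)}"
      using red_edge[of "i + 1"] red_edge[of "i + 3"] unfolding e by (simp_all add: insert_commute)
    have n: "v j \<noteq> v k" if "j \<noteq> k" "\<bar>j - k\<bar> < 8" for j k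
      using that assms(3) by (intro v_neq) auto
    \<comment> \<open>A red detour of five edges; its second and fifth are the edges
      \<open>i + 1\<close> and \<open>i + 3\<close> of the cycle, traversed in another
      order.\<close>
    show False
      using w z y reds_W[OF z(1)] reds_W[OF y(1)] reds_W[OF w] reds_D[OF z(1)] reds_D[OF y(1)] reds_D[OF w] r assms(3)
      by (intro detour4[of z "v (2 * i + 3)" "v (2 * i + 4)" "v (2 * i + 2)" y "v (2 * i + 1)" w "v (2 * i + 7)" "v (2 * i + 6)" i])
        (auto simp: v_neq_W n)
  qed
  then have "reds (v (2 * i + 7)) (v (2 * i + 1)) = {}" by (simp add: reds_commute[of "v (2 * i + 7)"]) blast
  moreover have "reds (v (2 * i + 1)) (v (2 * i)) = {}"
    using assms right_redD by (simp add: stuck_def reds_commute)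
  moreover have "distinct [v (2 * i + 7), v (2 * i + 1), v (2 * i)]"
    using assms(3) v_neq[of "2 * i + 7" "2 * i + 1"] v_neq[of "2 * i + 7" "2 * i"] by (simp add: v_neq4)
  ultimately show ?thesis
    using that ex_connector[of "2 * i + 7" "2 * i + 1" "2 * i" "{2 * i, 2 * i + 1, 2 * i + 7}"] by auto
qed

section \<open>Disjoint connectors along the cycle\<close>

definition connectors :: "(int set \<times> 'a) list \<Rightarrow> int set \<Rightarrow> bool" where
  "connectors Cs J \<longleftrightarrow> sorted_wrt (\<lambda>A B. fst A \<inter> fst B = {}) Cs \<and>
    (\<forall>C\<in>set Cs. fst C \<subseteq> J \<and> connector (fst C) (snd C))"

lemma connectors_Nil [simp]: "connectors [] J"
  by (simp add: connectors_def)

lemma connectors_mono: "connectors Cs J \<Longrightarrow> J \<subseteq> J' \<Longrightarrow> connectors Cs J'"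
  by (auto simp: connectors_def)

lemma connectors_append:
  "connectors Cs J \<Longrightarrow> connectors Ds K \<Longrightarrow> J \<inter> K = {} \<Longrightarrow> connectors (Cs @ Ds) (J \<union> K)"
  by (fastforce simp: connectors_def sorted_wrt_append)

lemma connectors_Cons:
  "connector I x \<Longrightarrow> connectors Cs J \<Longrightarrow> I \<inter> J = {} \<Longrightarrow> connectors ((I, x) # Cs) (I \<union> J)"
  by (fastforce simp: connectors_def)

text \<open>Scanning from left to right; a stuck pair takes its right end, unless the next pair is not
  linked, in which case the two pairs together carry two connectors avoiding that pair's right end.\<close>

lemma ex_connectors:
  assumes "2 * t \<le> l"
  shows "\<exists>Cs. length Cs = t \<and> connectors Cs {k \<in> {2 * i..2 * i + 4 * int t}.
    (k = 2 * i \<longrightarrow> \<not> linked i) \<and> (k = 2 * i + 4 * int t \<longrightarrow> stuck (i + 2 * int t - 2))}"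
  using assms
proof (induction t arbitrary: i rule: less_induct)
  case (less t)
  show ?case
  proof (cases t)
    case 0
    then show ?thesis by (intro exI[of _ "[]"]) simp
  next
    case t: (Suc t')
    let ?J = "{k \<in> {2 * i..2 * i + 4 * int t}.
      (k = 2 * i \<longrightarrow> \<not> linked i) \<and> (k = 2 * i + 4 * int t \<longrightarrow> stuck (i + 2 * int t - 2))}"
    let ?K = "{k \<in> {2 * i + 4..2 * i + 4 * int t}.
      (k = 2 * i + 4 \<longrightarrow> \<not> linked (i + 2)) \<and> (k = 2 * i + 4 * int t \<longrightarrow> stuck (i + 2 * int t - 2))}"
    have e: "2 * (i + 2) = 2 * i + 4" "2 * i + 4 + 4 * int t' = 2 * i + 4 * int t"
      "i + 2 + 2 * int t' - 2 = i + 2 * int t - 2" using t by auto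
    from less.IH[of t' "i + 2"] less.prems t obtain Cs where Cs: "length Cs = t'" "connectors Cs ?K"
      unfolding e by auto
    have cons: ?thesis if "connector I x" "I \<inter> ?K = {} \<or> t' = 0" "I \<subseteq> ?J" for I x
    proof (cases "t' = 0")
      case True
      then show ?thesis using that Cs(1) t by (intro exI[of _ "[(I, x)]"]) (simp add: connectors_def)
    next
      case False
      then have "?K \<subseteq> ?J" by auto
      moreover have "connectors ((I, x) # Cs) (I \<union> ?K)" using connectors_Cons Cs(2) that False by blast
      ultimately show ?thesis using Cs(1) t that(3)
        by (intro exI[of _ "(I, x) # Cs"]) (auto elim!: connectors_mono)
    qed
    consider "linked i" | "\<not> linked i" "\<not> stuck i" | "stuck i" "t' = 0 \<or> linked (i + 2)"
      | "stuck i" "\<not> linked (i + 2)" "t' \<noteq> 0" by blast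
    then show ?thesis
    proof cases
      case 1
      then obtain x where "connector {2 * i + 1..2 * i + 3} x" by (rule connector_linked)
      then show ?thesis using t by (intro cons) auto
    next
      case 2
      then obtain x where "connector {2 * i..2 * i + 3} x" by (rule connector_not_linked)
      then show ?thesis using t 2 by (intro cons) auto
    next
      case 3
      then obtain x where "connector {2 * i + 1..2 * i + 4} x" by (blast intro: connector_stuck)
      then show ?thesis using t 3 by (intro cons) auto
    next
      case 4
      then obtain t'' where t'': "t' = Suc t''" by (auto simp: gr0_conv_Suc)
      \<comment> \<open>The two connectors lie in the edges \<open>i\<close> to \<open>i + 3\<close>
        and miss the joint \<open>2 * i + 8\<close>, so the scan can resume at \<open>i + 4\<close>
        whether or not that pair is linked.\<close>
      let ?L = "{k \<in> {2 * i + 8..2 * i + 4 * int t}.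
        (k = 2 * i + 8 \<longrightarrow> \<not> linked (i + 4)) \<and> (k = 2 * i + 4 * int t \<longrightarrow> stuck (i + 2 * int t - 2))}"
      have e: "2 * (i + 4) = 2 * i + 8" "2 * i + 8 + 4 * int t'' = 2 * i + 4 * int t"
        "i + 4 + 2 * int t'' - 2 = i + 2 * int t - 2" using t t'' by auto
      from less.IH[of t'' "i + 4"] less.prems t t'' obtain Ds where Ds: "length Ds = t''" "connectors Ds ?L"
        unfolding e by auto
      have "l \<ge> 4" using less.prems t t'' by simp
      then obtain x y where xy: "connector {2 * i + 3..2 * i + 5} x" "connector {2 * i, 2 * i + 1, 2 * i + 7} y"
        using connector_stuck_pair 4 by blast
      have "connectors (({2 * i, 2 * i + 1, 2 * i + 7}, y) # Ds) ({2 * i, 2 * i + 1, 2 * i + 7} \<union> ?L)"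
        by (rule connectors_Cons) (use xy Ds in auto)
      then have "connectors (({2 * i + 3..2 * i + 5}, x) # ({2 * i, 2 * i + 1, 2 * i + 7}, y) # Ds)
          ({2 * i + 3..2 * i + 5} \<union> ({2 * i, 2 * i + 1, 2 * i + 7} \<union> ?L))"
        by (rule connectors_Cons[OF xy(1)]) auto
      then have "connectors (({2 * i + 3..2 * i + 5}, x) # ({2 * i, 2 * i + 1, 2 * i + 7}, y) # Ds) ?J"
        by (rule connectors_mono) (use t t'' 4(1) stuck_not_linked in auto)
      then show ?thesis using Ds(1) t t'' by (intro exI conjI) auto
    qed
  qed
qed

text \<open>With this index the mirrored pair consists of the same edges \<open>i\<close> and
  \<open>i + 1\<close>.\<close>

abbreviation "stuck_reverse i \<equiv> red_cycle.stuck red (\<lambda>i. v (- i)) W (- i - 2)"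

lemma reverse_connectors:
  "red_cycle.connectors red (\<lambda>i. v (- i)) W Cs J \<Longrightarrow>
    connectors (map (map_prod (image uminus) id) Cs) (uminus ` J)"
proof -
  interpret rev: red_cycle red "\<lambda>i. v (- i)" l W by (rule reverse)
  assume "rev.connectors Cs J"
  moreover have "(uminus ` A \<inter> uminus ` B = {}) = (A \<inter> B = {})" for A B :: "int set"
    by (metis image_Int image_is_empty inj_uminus)
  ultimately show ?thesis
    by (force simp: rev.connectors_def connectors_def sorted_wrt_map reverse_connector)
qed

text \<open>Mirror image of \<open>ex_connectors\<close> on the same window: the scan runs from
  right to left, so the conditions at the ends change places.\<close>

lemma ex_connectors_reverse:
  assumes "2 * t \<le> l"
  shows "\<exists>Cs. length Cs = t \<and> connectors Cs {k \<in> {2 * i..2 * i + 4 * int t}.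
    (k = 2 * i + 4 * int t \<longrightarrow> \<not> linked (i + 2 * int t - 2)) \<and> (k = 2 * i \<longrightarrow> stuck_reverse i)}"
proof -
  interpret rev: red_cycle red "\<lambda>i. v (- i)" l W by (rule reverse)
  let ?j = "- i - 2 * int t"
  from rev.ex_connectors[OF assms, of ?j] obtain Cs where Cs: "length Cs = t"
    "rev.connectors Cs {k \<in> {2 * ?j..2 * ?j + 4 * int t}.
      (k = 2 * ?j \<longrightarrow> \<not> rev.linked ?j) \<and> (k = 2 * ?j + 4 * int t \<longrightarrow> rev.stuck (?j + 2 * int t - 2))}" by blast
  have "connectors (map (map_prod (image uminus) id) Cs) {k \<in> {2 * i..2 * i + 4 * int t}.
    (k = 2 * i + 4 * int t \<longrightarrow> \<not> linked (i + 2 * int t - 2)) \<and> (k = 2 * i \<longrightarrow> stuck_reverse i)}"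
    by (rule connectors_mono[OF reverse_connectors[OF Cs(2)]]) (auto simp: reverse_linked algebra_simps)
  then show ?thesis using Cs(1) by (intro exI[of _ "map (map_prod (image uminus) id) Cs"]) simp
qed

text \<open>Both ends are avoided by scanning away from a linked pair in both directions.\<close>

lemma ex_connectors_cut:
  assumes "2 * t \<le> l" "s < t" "linked (i + 2 * int s)"
    "\<not> stuck_reverse i" "\<not> stuck (i + 2 * int t - 2)"
  shows "\<exists>Cs. length Cs = t \<and> connectors Cs {2 * i<..<2 * i + 4 * int t}"
proof -
  obtain Cs where Cs: "length Cs = s" "connectors Cs {k \<in> {2 * i..2 * i + 4 * int s}.
    (k = 2 * i + 4 * int s \<longrightarrow> \<not> linked (i + 2 * int s - 2)) \<and> (k = 2 * i \<longrightarrow> stuck_reverse i)}"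
    using ex_connectors_reverse[of s i] assms by auto
  obtain x where x: "connector {2 * (i + 2 * int s) + 1..2 * (i + 2 * int s) + 3} x"
    using connector_linked assms(3) by blast
  define r where "r = t - s - 1"
  have "2 * r \<le> l" using assms by (simp add: r_def)
  let ?j = "i + 2 * int s + 2"
  obtain Ds where Ds: "length Ds = r" "connectors Ds {k \<in> {2 * ?j..2 * ?j + 4 * int r}.
    (k = 2 * ?j \<longrightarrow> \<not> linked ?j) \<and> (k = 2 * ?j + 4 * int r \<longrightarrow> stuck (?j + 2 * int r - 2))}"
    using ex_connectors[OF \<open>2 * r \<le> l\<close>, of ?j] by blast
  have Cs': "connectors Cs {2 * i<..2 * i + 4 * int s}"
    by (rule connectors_mono[OF Cs(2)]) (use assms(4) in auto)
  have rt: "int r = int t - int s - 1" using assms(2) by (simp add: r_def)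
  have Ds': "connectors Ds {2 * i + 4 * int s + 4..<2 * i + 4 * int t}"
    by (rule connectors_mono[OF Ds(2)]) (use assms(5) in \<open>auto simp: rt algebra_simps\<close>)
  have "connectors (({2 * (i + 2 * int s) + 1..2 * (i + 2 * int s) + 3}, x) # Ds)
    ({2 * (i + 2 * int s) + 1..2 * (i + 2 * int s) + 3} \<union> {2 * i + 4 * int s + 4..<2 * i + 4 * int t})"
    by (rule connectors_Cons[OF x Ds']) auto
  from connectors_append[OF Cs' this]
  have "connectors (Cs @ ({2 * (i + 2 * int s) + 1..2 * (i + 2 * int s) + 3}, x) # Ds) {2 * i<..<2 * i + 4 * int t}"
    by (rule connectors_mono) (use assms(2) in auto)
  then show ?thesis using Cs(1) Ds(1) assms(2) by (intro exI conjI) (auto simp: r_def)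
qed

section \<open>Closing a chain of connectors\<close>

definition blue_cycle :: "nat \<Rightarrow> bool" where
  "blue_cycle n \<longleftrightarrow> (\<exists>xs. closed_loose_path (\<lambda>e. blue e) xs \<and> length xs = 2 * n \<and> set xs \<subseteq> range v \<union> W)"

lemma reverse_blue_cycle: "red_cycle.blue_cycle red (\<lambda>i. v (- i)) W n \<Longrightarrow> blue_cycle n"
proof -
  interpret rev: red_cycle red "\<lambda>i. v (- i)" l W by (rule reverse)
  have "range (\<lambda>i. v (- i)) = range v" by (metis image_image surj_uminus)
  then show "rev.blue_cycle n \<Longrightarrow> blue_cycle n" by (simp add: rev.blue_cycle_def blue_cycle_def)
qed

text \<open>Since \<open>v\<close> is periodic, injectivity on \<open>J\<close> is what turns
  disjoint index sets into disjoint vertex sets.\<close>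

definition chain :: "(int set \<times> 'a) list \<Rightarrow> 'a list \<Rightarrow> int set \<Rightarrow> bool" where
  "chain Cs ws J \<longleftrightarrow> connectors Cs J \<and> inj_on v J \<and> distinct ws \<and> set ws \<subseteq> W \<and>
    length ws = length Cs + 1 \<and> (\<forall>i<length Cs. link (fst (Cs ! i)) (ws ! i) (ws ! Suc i))"

lemma chain_path:
  assumes "chain Cs ws J"
  shows "\<exists>ps. loose_path (\<lambda>e. blue e) ps \<and> hd ps = hd ws \<and> last ps = last ws \<and>
    length ps = 4 * length Cs + 1 \<and> distinct ps \<and> set ps \<subseteq> set ws \<union> v ` J"
proof -
  have ch: "connectors Cs J" "inj_on v J" "distinct ws" "set ws \<subseteq> W" "length ws = length Cs + 1"
    "\<forall>i<length Cs. link (fst (Cs ! i)) (ws ! i) (ws ! Suc i)"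
    using assms by (auto simp: chain_def)
  let ?Ts = "map (\<lambda>C. v ` fst C) Cs"
  have sub: "\<Union>(set ?Ts) \<subseteq> v ` J" using ch(1) by (fastforce simp: connectors_def)
  have disj: "v ` fst C \<inter> v ` fst D = {}" if "C \<in> set Cs" "D \<in> set Cs" "fst C \<inter> fst D = {}" for C D
  proof -
    have "fst C \<subseteq> J" "fst D \<subseteq> J" using that ch(1) by (simp_all add: connectors_def)
    then have "v ` (fst C \<inter> fst D) = v ` fst C \<inter> v ` fst D" by (rule inj_on_image_Int[OF ch(2)])
    then show ?thesis using that(3) by simp
  qed
  have "sorted_wrt (\<lambda>C D. v ` fst C \<inter> v ` fst D = {}) Cs"
    by (rule sorted_wrt_mono_rel[of Cs "\<lambda>A B. fst A \<inter> fst B = {}"])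
      (use disj ch(1) in \<open>simp_all add: connectors_def\<close>)
  then have "sorted_wrt (\<lambda>A B. A \<inter> B = {}) ?Ts" by (simp add: sorted_wrt_map)
  moreover have "set ws \<inter> \<Union>(set ?Ts) = {}" using sub ch(4) v_notin by auto
  moreover have "\<forall>i<length ?Ts. two_link (\<lambda>e. blue e) (?Ts ! i) (ws ! i) (ws ! Suc i)"
    using ch(6) by (simp add: link_def)
  moreover have "length ws = Suc (length ?Ts)" using ch(5) by simp
  ultimately obtain ps where ps: "loose_path (\<lambda>e. blue e) ps" "hd ps = hd ws" "last ps = last ws"
    "length ps = 4 * length ?Ts + 1" "distinct ps" "set ps \<subseteq> set ws \<union> \<Union>(set ?Ts)"
    using two_link_chain[of ws ?Ts "\<lambda>e. blue e"] ch(3) by blast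
  have "set ps \<subseteq> set ws \<union> v ` J" using ps(6) sub by (meson Un_mono order_refl order_trans)
  then show ?thesis using ps by (intro exI[of _ ps]) simp
qed

text \<open>A chain of \<open>c\<close> connectors is a path of \<open>2 * c\<close> edges on
  \<open>4 * c + 1\<close> vertices. With one, three or five vertices in \<open>es\<close> it closes
  to a cycle of length \<open>2 * c + 1\<close>, \<open>2 * c + 2\<close> or
  \<open>2 * c + 3\<close>.\<close>

lemma close_chain:
  assumes ch: "chain Cs ws J" and es: "loose_path (\<lambda>e. blue e) (last ws # es @ [hd ws])" "distinct es"
    "set es \<subseteq> range v \<union> W" "set es \<inter> (v ` J \<union> set ws) = {}" "2 * n = 4 * length Cs + 1 + length es"
  shows "blue_cycle n"
proof -
  obtain ps where ps: "loose_path (\<lambda>e. blue e) ps" "hd ps = hd ws" "last ps = last ws"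
    "length ps = 4 * length Cs + 1" "distinct ps" "set ps \<subseteq> set ws \<union> v ` J"
    using chain_path[OF ch] by blast
  have ne: "ps \<noteq> []" using ps(4) by auto
  have "loose_path (\<lambda>e. blue e) (butlast ps @ last ps # es @ [hd ps])"
  proof (rule loose_path_append)
    show "loose_path (\<lambda>e. blue e) (butlast ps @ [last ps])" unfolding append_butlast_last_id[OF ne] by (rule ps(1))
    show "loose_path (\<lambda>e. blue e) (last ps # es @ [hd ps])" using es(1) ps(2,3) by simp
  qed
  also have "butlast ps @ last ps # es @ [hd ps] = (butlast ps @ [last ps]) @ es @ [hd ps]" by simp
  also have "\<dots> = (ps @ es) @ [hd (ps @ es)]" unfolding append_butlast_last_id[OF ne] using ne by simp
  finally have "loose_path (\<lambda>e. blue e) ((ps @ es) @ [hd (ps @ es)])" .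
  moreover have "distinct (ps @ es)" using ps(5,6) es(2,4) by auto
  moreover have "set (ps @ es) \<subseteq> range v \<union> W" using ps(6) es(3) ch by (auto simp: chain_def)
  ultimately show ?thesis
    unfolding blue_cycle_def closed_loose_path_def using ne ps(4) es(5) by (intro exI[of _ "ps @ es"]) auto
qed

lemma ex_chain:
  assumes "connectors Cs J" "inj_on v J" "card W \<ge> length Cs + 2" "w \<in> W" "Cs \<noteq> [] \<Longrightarrow> w \<noteq> snd (hd Cs)"
  obtains ws where "chain Cs ws J" "hd ws = w"
proof -
  have "\<exists>ws. distinct ws \<and> set ws \<subseteq> W \<and> length ws = length (map snd Cs) + 1 \<and> hd ws = w \<and>
    (\<forall>i<length (map snd Cs). ws ! i \<noteq> map snd Cs ! i \<and> ws ! Suc i \<noteq> map snd Cs ! i)"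
    by (rule ex_sequence_avoiding) (use assms finite_W in \<open>auto simp: hd_map\<close>)
  then obtain ws where ws: "distinct ws" "set ws \<subseteq> W" "length ws = length Cs + 1" "hd ws = w"
    "\<forall>i<length Cs. ws ! i \<noteq> snd (Cs ! i) \<and> ws ! Suc i \<noteq> snd (Cs ! i)" by auto
  have "link (fst (Cs ! i)) (ws ! i) (ws ! Suc i)" if "i < length Cs" for i
  proof -
    have "connector (fst (Cs ! i)) (snd (Cs ! i))" using assms(1) that by (auto simp: connectors_def)
    moreover have "ws ! i \<in> W" "ws ! Suc i \<in> W" using ws(2,3) that by (auto intro!: subsetD[OF ws(2)])
    moreover have "ws ! i \<noteq> ws ! Suc i" using ws(1,3) that by (simp add: nth_eq_iff_index_eq)
    ultimately show ?thesis using ws(5) that by (auto simp: connector_def)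
  qed
  then show ?thesis using that ws assms by (auto simp: chain_def)
qed

text \<open>With a common exception only \<open>x\<close> has to be avoided, so the sequence, and in
  particular both its ends, can be prescribed.\<close>

lemma chain_constant:
  assumes "connectors Cs J" "inj_on v J" "\<forall>C\<in>set Cs. snd C = x"
    "distinct ws" "set ws \<subseteq> W - {x}" "length ws = length Cs + 1"
  shows "chain Cs ws J"
proof -
  have "link (fst (Cs ! i)) (ws ! i) (ws ! Suc i)" if "i < length Cs" for i
  proof -
    have "connector (fst (Cs ! i)) x" using assms(1,3) that by (auto simp: connectors_def)
    moreover have "ws ! i \<in> W - {x}" "ws ! Suc i \<in> W - {x}"
      using that by (auto intro!: subsetD[OF assms(5)] simp: assms(6) simp del: Diff_iff)
    moreover have "ws ! i \<noteq> ws ! Suc i" using assms(4,6) that by (simp add: nth_eq_iff_index_eq)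
    ultimately show ?thesis by (simp add: connector_def)
  qed
  then show ?thesis using assms by (auto simp: chain_def)
qed

text \<open>The order of the connectors is free, and a prescribed first vertex can conflict only
  with the exception of the first connector, so \<open>C\<close> is moved to the front.\<close>

lemma ex_chain_from:
  assumes "connectors Cs J" "inj_on v J" "card W \<ge> length Cs + 2" "w \<in> W" "C \<in> set Cs" "snd C \<noteq> w"
  obtains Ds ws where "chain Ds ws J" "hd ws = w" "length Ds = length Cs"
proof -
  obtain As Bs where Cs: "Cs = As @ C # Bs" using assms(5) by (auto dest: split_list)
  have "connectors (C # As @ Bs) J"
    using assms(1) by (fastforce simp: Cs connectors_def sorted_wrt_append)
  then obtain ws where "chain (C # As @ Bs) ws J" "hd ws = w"
    by (rule ex_chain[of "C # As @ Bs" J w]) (use assms in \<open>simp_all add: Cs\<close>)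
  then show ?thesis using that by (simp add: Cs)
qed

lemma last_neq_hd_chain: "chain Cs ws J \<Longrightarrow> Cs \<noteq> [] \<Longrightarrow> last ws \<noteq> hd ws"
  by (cases ws; cases "tl ws") (auto simp: chain_def)

lemma chain_nonempty: "chain Cs ws J \<Longrightarrow> ws \<noteq> []"
  by (auto simp: chain_def)

lemma chain_ends: "chain Cs ws J \<Longrightarrow> hd ws \<in> W \<and> last ws \<in> W \<and> hd ws \<in> set ws \<and> last ws \<in> set ws"
  using chain_nonempty[of Cs ws J] by (auto simp: chain_def)

lemma v_notin_chain: "chain Cs ws J \<Longrightarrow> v k \<notin> set ws"
  using v_notin by (auto simp: chain_def)

lemma v_image_notin: "x \<in> W \<Longrightarrow> x \<notin> v ` J"
  using v_notin by auto

lemma card_chain: "chain Cs ws J \<Longrightarrow> card (set ws) = length Cs + 1"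
  by (simp add: chain_def distinct_card)

text \<open>The witness \<open>y\<close> is the first vertex of the chain or, if it is the exception of all
  connectors, the spare vertex in the closing path.\<close>

lemma even_cycle_from_witness:
  assumes Cs: "connectors Cs J" "inj_on v J" "Cs \<noteq> []" and W: "card W \<ge> length Cs + 2"
    and y: "y \<in> reds (v (2 * i + 1)) (v (2 * i + 2))" and J: "v (2 * i) \<notin> v ` J" "v (2 * i + 1) \<notin> v ` J"
  shows "blue_cycle (2 * length Cs + 2)"
proof -
  note yW = reds_W[OF y]
  have close: "blue_cycle (2 * length Ds + 2)"
    if ch: "chain Ds ws J" and s: "s \<in> W" "s \<notin> set ws" and last: "last ws \<noteq> y" and ys: "y = s \<or> y = hd ws" for Ds ws s
  proof -
    \<comment> \<open>The closing edges are \<open>{last ws, v (2 * i + 1), v (2 * i)}\<close>, blue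
      by \<open>reds_crossing\<close>, and \<open>{v (2 * i), s, hd ws}\<close>, blue by
      \<open>blue_witness\<close> because it contains \<open>y\<close>.\<close>
    have "last ws \<notin> reds (v (2 * i)) (v (2 * i + 1))" using reds_crossing y last by blast
    then have "blue {last ws, v (2 * i + 1), v (2 * i)}"
      using chain_ends[OF ch] by (simp add: reds_def insert_commute)
    moreover have "s \<noteq> hd ws" using s chain_ends[OF ch] by auto
    then have "blue {v (2 * i), s, hd ws}"
      using ys blue_witness[OF y, of s] blue_witness[OF y, of "hd ws"] s chain_ends[OF ch]
      by (auto simp: insert_commute)
    ultimately show ?thesis
      using J s ch by (intro close_chain[OF ch, of "[v (2 * i + 1), v (2 * i), s]"])
        (auto simp: v_neq_W v_neq4 v_notin_chain[OF ch] v_image_notin)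
  qed
  show ?thesis
  proof (cases "\<exists>C\<in>set Cs. snd C \<noteq> y")
    case True
    then obtain C where C: "C \<in> set Cs" "snd C \<noteq> y" by blast
    obtain Ds ws where ch: "chain Ds ws J" "hd ws = y" "length Ds = length Cs"
      by (rule ex_chain_from[OF Cs(1,2) W yW C])
    have "Ds \<noteq> []" using ch(3) Cs(3) by auto
    then have last: "last ws \<noteq> y" using last_neq_hd_chain[OF ch(1)] ch(2) by simp
    have "card (set ws) < card W" using card_chain[OF ch(1)] W ch(3) by simp
    then obtain s where "s \<in> W" "s \<notin> set ws" by (rule ex_avoiding) auto
    then show ?thesis using close[OF ch(1) _ _ last] ch(2,3) by simp
  next
    case False
    have "length Cs + 1 \<le> card (W - {y})" using W yW finite_W by simp
    then obtain ws where ws: "distinct ws" "set ws \<subseteq> W - {y}" "length ws = length Cs + 1"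
      using ex_distinct_list[of "W - {y}"] finite_W by (metis finite_Diff)
    have ch: "chain Cs ws J" by (rule chain_constant[OF Cs(1,2) _ ws]) (use False in auto)
    have "y \<notin> set ws" using ws(2) by auto
    moreover have "last ws \<noteq> y" using chain_ends[OF ch] calculation by auto
    ultimately show ?thesis using close[OF ch yW] by simp
  qed
qed

text \<open>A right red edge has two witnesses, so one of them differs from the exception of the
  first connector and can start the chain. By \<open>blue_witness\<close> it forms a blue triple
  with \<open>v (2 * i)\<close> and the last vertex.\<close>

lemma odd_cycle_from_right_red:
  assumes Cs: "connectors Cs J" "inj_on v J" "Cs \<noteq> []" and W: "card W \<ge> length Cs + 2"
    and i: "right_red i" and J: "v (2 * i) \<notin> v ` J"
  shows "blue_cycle (2 * length Cs + 1)"
proof -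
  have C: "hd Cs \<in> set Cs" using Cs(3) by simp
  obtain y where y: "y \<in> reds (v (2 * i + 1)) (v (2 * i + 2))" "y \<noteq> snd (hd Cs)"
    using i unfolding right_red_def by (rule reds_avoiding)
  obtain Ds ws where ch: "chain Ds ws J" "hd ws = y" "length Ds = length Cs"
    by (rule ex_chain_from[OF Cs(1,2) W reds_W[OF y(1)] C y(2)[symmetric]])
  have "Ds \<noteq> []" using ch(3) Cs(3) by auto
  then have "last ws \<noteq> y" using last_neq_hd_chain[OF ch(1)] ch(2) by simp
  then have "blue {v (2 * i), y, last ws}"
    using blue_witness[OF y(1), of "last ws"] chain_ends[OF ch(1)] by simp
  then have "blue {last ws, v (2 * i), hd ws}" by (simp add: insert_commute ch(2))
  then show ?thesis
    using J ch(3) by (intro close_chain[OF ch(1), of "[v (2 * i)]"]) (auto simp: v_notin_chain[OF ch(1)])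
qed

lemma v_notin_image:
  assumes "j \<in> {a..<a + 2 * int l}" "J \<subseteq> {a..<a + 2 * int l}" "j \<notin> J"
  shows "v j \<notin> v ` J"
  using assms inj_on_image_mem_iff[OF inj_on_v[of a] assms(1,2)] by simp

lemma inj_on_v_subset: "J \<subseteq> {a..<a + 2 * int l} \<Longrightarrow> inj_on v J"
  using inj_on_v inj_on_subset by blast

text \<open>Only \<open>l = 2 * t + 1\<close> is critical: if the last pair were stuck for every admissible \<open>i\<close>, then going
  back two edges at a time around the odd cycle would make all edges right red.\<close>

lemma ex_connectors_beside:
  assumes t: "2 * t + 1 \<le> l" and X: "X i" "\<And>i. right_red i \<Longrightarrow> X i"
  shows "\<exists>i Cs. X i \<and> length Cs = t \<and> connectors Cs {2 * i + 2..<2 * i + 2 * int l}"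
proof -
  have "\<exists>j. X j \<and> (l = 2 * t + 1 \<longrightarrow> \<not> stuck (j + int l - 2))"
  proof (rule ccontr)
    assume *: "\<nexists>j. X j \<and> (l = 2 * t + 1 \<longrightarrow> \<not> stuck (j + int l - 2))"
    then have l: "int l = 2 * int t + 1" using X(1) by auto
    have step: "right_red (j - 2) \<and> \<not> right_red (j - 1)" if "X j" for j
    proof -
      have "stuck (j + int l - 2)" using * that by auto
      moreover have "j + int l - 2 = j - 2 + int l" "j - 2 + int l + 1 = j - 1 + int l" by auto
      ultimately have "right_red (j - 2 + int l) \<and> \<not> right_red (j - 1 + int l)" unfolding stuck_def by metis
      then show ?thesis by simp
    qed
    have desc: "X (i - 2 * int n)" for n
    proof (induction n)
      case (Suc n)
      then show ?case using step[of "i - 2 * int n"] X(2)[of "i - 2 * int n - 2"] by (simp add: algebra_simps)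
    qed (use X in simp)
    \<comment> \<open>After \<open>t + 1\<close> steps the index is \<open>i - 1 - int l\<close>, so
      edge \<open>i - 1\<close> is right red, against the first step.\<close>
    have "right_red (i - 2 * int t - 2)" using step[OF desc[of t]] by simp
    moreover have "i - 1 = (i - 2 * int t - 2) + int l" using l by simp
    ultimately have "right_red (i - 1)" by (metis right_red_periodic)
    then show False using step[OF X(1)] by simp
  qed
  then obtain j where j: "X j" "l = 2 * t + 1 \<longrightarrow> \<not> stuck (j + int l - 2)" by blast
  \<comment> \<open>Edge \<open>j\<close> is skipped. For \<open>l = 2 * t + 1\<close> the window
    ends at \<open>2 * j + 2 * int l\<close>, the same joint as \<open>2 * j\<close>, which the
    choice of \<open>j\<close> keeps free.\<close>
  obtain Cs where Cs: "length Cs = t" "connectors Cs {k \<in> {2 * (j + 1)..2 * (j + 1) + 4 * int t}.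
    (k = 2 * (j + 1) \<longrightarrow> \<not> linked (j + 1)) \<and> (k = 2 * (j + 1) + 4 * int t \<longrightarrow> stuck (j + 1 + 2 * int t - 2))}"
    using ex_connectors[of t "j + 1"] t by auto
  have "connectors Cs {2 * j + 2..<2 * j + 2 * int l}"
  proof (rule connectors_mono[OF Cs(2)], rule subsetI)
    fix k assume k: "k \<in> {k \<in> {2 * (j + 1)..2 * (j + 1) + 4 * int t}.
      (k = 2 * (j + 1) \<longrightarrow> \<not> linked (j + 1)) \<and> (k = 2 * (j + 1) + 4 * int t \<longrightarrow> stuck (j + 1 + 2 * int t - 2))}"
    show "k \<in> {2 * j + 2..<2 * j + 2 * int l}"
    proof (cases "l = 2 * t + 1")
      case True
      then have "j + 1 + 2 * int t - 2 = j + int l - 2" by simp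
      then have "k \<noteq> 2 * (j + 1) + 4 * int t" using k j(2) True by auto
      then show ?thesis using k True by auto
    next
      case False
      then show ?thesis using k t by auto
    qed
  qed
  then show ?thesis using j(1) Cs(1) by blast
qed

section \<open>Blue cycles of even length\<close>

lemma even_cycle_left_witness:
  assumes "k \<ge> 2" "card W \<ge> k + 1" "2 * k \<le> l + 1" "reds (v (2 * i + 1)) (v (2 * i + 2)) \<noteq> {}"
  shows "blue_cycle (2 * k)"
proof -
  define X where "X i \<longleftrightarrow> reds (v (2 * i + 1)) (v (2 * i + 2)) \<noteq> {}" for i
  have X: "X j" if "right_red j" for j using that by (auto simp: right_red_def X_def)
  have "2 * (k - 1) + 1 \<le> l" "X i" using assms by (auto simp: X_def)
  then obtain i Cs where i: "X i" and Cs: "length Cs = k - 1" "connectors Cs {2 * i + 2..<2 * i + 2 * int l}"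
    using ex_connectors_beside[of "k - 1" X] X by blast
  obtain y where y: "y \<in> reds (v (2 * i + 1)) (v (2 * i + 2))" using i by (auto simp: X_def)
  have sub: "{2 * i + 2..<2 * i + 2 * int l} \<subseteq> {2 * i..<2 * i + 2 * int l}" by auto
  have "blue_cycle (2 * length Cs + 2)"
    using assms Cs len2 by (intro even_cycle_from_witness[OF Cs(2) inj_on_v_subset[OF sub] _ _ y] v_notin_image[OF _ sub]) auto
  moreover have "2 * length Cs + 2 = 2 * k" using Cs(1) assms(1) by simp
  ultimately show ?thesis by simp
qed

lemma even_cycle:
  assumes "k \<ge> 2" "card W \<ge> k + 1" "2 * k \<le> l + 1"
  shows "blue_cycle (2 * k)"
proof -
  interpret rev: red_cycle red "\<lambda>i. v (- i)" l W by (rule reverse)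
  consider i where "reds (v (2 * i + 1)) (v (2 * i + 2)) \<noteq> {}" | i where "reds (v (2 * i)) (v (2 * i + 1)) \<noteq> {}"
    | "\<And>i. reds (v (2 * i)) (v (2 * i + 1)) = {} \<and> reds (v (2 * i + 1)) (v (2 * i + 2)) = {}" by blast
  then show ?thesis
  proof cases
    case 1
    then show ?thesis using even_cycle_left_witness assms by blast
  next
    case (2 i)
    have "2 * i = - (2 * (- i - 1) + 2)" "2 * i + 1 = - (2 * (- i - 1) + 1)" by auto
    then have "reds (v (- (2 * (- i - 1) + 1))) (v (- (2 * (- i - 1) + 2))) \<noteq> {}"
      using 2 by (metis reds_commute)
    from rev.even_cycle_left_witness[OF assms this] show ?thesis by (rule reverse_blue_cycle)
  next
    case 3
    \<comment> \<open>Without witnesses every pair is linked and none is stuck, so the connectors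
      avoid both ends of the window and \<open>v 0, v 1, v 2\<close> are free for the closing
      path.\<close>
    have no: "\<not> right_red j" "\<not> left_red j" "linked j" "\<not> stuck j" for j
      using 3[of j] 3[of "j + 1"] by (auto simp: right_red_def left_red_def linked_def stuck_def)
    let ?J = "{3..<2 * int l}"
    have J: "?J \<subseteq> {0..<0 + 2 * int l}" by auto
    have "2 * (k - 1) \<le> l" using assms by simp
    then obtain Cs where Cs: "length Cs = k - 1" "connectors Cs {j \<in> {2 * 1..2 * 1 + 4 * int (k - 1)}.
      (j = 2 * 1 \<longrightarrow> \<not> linked 1) \<and> (j = 2 * 1 + 4 * int (k - 1) \<longrightarrow> stuck (1 + 2 * int (k - 1) - 2))}"
      using ex_connectors[of "k - 1" 1] by blast
    have CsJ: "connectors Cs ?J"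
    proof (rule connectors_mono[OF Cs(2)], rule subsetI)
      fix j assume "j \<in> {j \<in> {2 * 1..2 * 1 + 4 * int (k - 1)}.
        (j = 2 * 1 \<longrightarrow> \<not> linked 1) \<and> (j = 2 * 1 + 4 * int (k - 1) \<longrightarrow> stuck (1 + 2 * int (k - 1) - 2))}"
      then have "2 < j" "j < 2 + 4 * int (k - 1)" using no by (auto simp: order.order_iff_strict)
      then show "j \<in> ?J" using assms by auto
    qed
    obtain w where w: "w \<in> W" "w \<noteq> snd (hd Cs)"
      using ex_avoiding[of "{snd (hd Cs)}" W] assms by auto
    obtain ws where ch: "chain Cs ws ?J" "hd ws = w"
      by (rule ex_chain[OF CsJ inj_on_v_subset[OF J] _ w(1)]) (use assms Cs(1) w(2) in auto)
    have e: "v 0 \<notin> v ` ?J" "v 1 \<notin> v ` ?J" "v 2 \<notin> v ` ?J"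
      by (rule v_notin_image[OF _ J]; use len2 in auto)+
    have "blue {last ws, v 0, v 1}" "blue {v 1, v 2, hd ws}"
      using 3[of 0] chain_ends[OF ch(1)] by (auto simp: reds_def insert_commute)
    then have "blue_cycle (2 * k)"
      using e assms Cs(1) by (intro close_chain[OF ch(1), of "[v 0, v 1, v 2]"])
        (auto simp: v_neq4 v_notin_chain[OF ch(1)] simp del: image_iff)
    then show ?thesis .
  qed
qed

section \<open>Blue cycles of odd length\<close>

text \<open>With \<open>z\<close> outside \<open>W\<close>, such as \<open>v 0\<close>, this says
  that both pairs are blue with all of \<open>W\<close>.\<close>

definition light_edge :: "'a \<Rightarrow> int \<Rightarrow> bool" where
  "light_edge z i \<longleftrightarrow> reds (v (2 * i)) (v (2 * i + 1)) \<subseteq> {z} \<and> reds (v (2 * i + 1)) (v (2 * i + 2)) \<subseteq> {z}"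

lemma connector_light_edges:
  assumes "light_edge z i" "light_edge z (i + 1)"
  shows "connector {2 * i + 1..2 * i + 3} z"
  unfolding connector_def
proof (intro ballI impI)
  fix u w assume uw: "u \<in> W - {z}" "w \<in> W - {z}"
  have e: "2 * (i + 1) = 2 * i + 2" "2 * i + 2 + 1 = 2 * i + 3" by auto
  have "reds (v (2 * i + 1)) (v (2 * i + 2)) \<subseteq> {z}" "reds (v (2 * i + 2)) (v (2 * i + 3)) \<subseteq> {z}"
    using assms unfolding light_edge_def e by auto
  then show "link {2 * i + 1..2 * i + 3} u w"
    using uw by (intro linkI(1)[of "2 * i + 1" "2 * i + 2" "2 * i + 3"]) (auto simp: v_neq4)
qed

lemma connector_light_edge:
  assumes "light_edge z i"
  shows "connector {2 * i..2 * i + 2} z"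
  unfolding connector_def
proof (intro ballI impI)
  fix u w assume uw: "u \<in> W - {z}" "w \<in> W - {z}"
  then show "link {2 * i..2 * i + 2} u w"
    using assms unfolding light_edge_def
    by (intro linkI(1)[of "2 * i" "2 * i + 1" "2 * i + 2"]) (auto simp: v_neq4)
qed

lemma connectors_light:
  assumes "\<And>j. i \<le> j \<Longrightarrow> j < i + 2 * int n \<Longrightarrow> light_edge z j"
  shows "\<exists>Cs. length Cs = n \<and> connectors Cs {2 * i<..<2 * i + 4 * int n} \<and> (\<forall>C\<in>set Cs. snd C = z)"
  using assms
proof (induction n arbitrary: i)
  case 0
  then show ?case by (intro exI[of _ "[]"]) simp
next
  case (Suc n)
  have "\<exists>Cs. length Cs = n \<and> connectors Cs {2 * (i + 2)<..<2 * (i + 2) + 4 * int n} \<and> (\<forall>C\<in>set Cs. snd C = z)"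
    by (rule Suc.IH) (use Suc.prems in auto)
  then obtain Cs where Cs: "length Cs = n" "connectors Cs {2 * (i + 2)<..<2 * (i + 2) + 4 * int n}"
    "\<forall>C\<in>set Cs. snd C = z" by blast
  have "connectors (({2 * i + 1..2 * i + 3}, z) # Cs) ({2 * i + 1..2 * i + 3} \<union> {2 * (i + 2)<..<2 * (i + 2) + 4 * int n})"
    by (rule connectors_Cons[OF connector_light_edges Cs(2)]) (use Suc.prems in auto)
  then have "connectors (({2 * i + 1..2 * i + 3}, z) # Cs) {2 * i<..<2 * i + 4 * int (Suc n)}"
    by (rule connectors_mono) auto
  then show ?case using Cs by (intro exI[of _ "({2 * i + 1..2 * i + 3}, z) # Cs"]) auto
qed

text \<open>Closing at two adjacent joints \<open>a, c\<close> fails only if \<open>{a, x, y}\<close> and \<open>{c, y, w}\<close> are red, and then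
  the edge between \<open>a\<close> and \<open>c\<close> can be replaced by two.\<close>

lemma odd_cycle_light:
  assumes k: "k \<ge> 1" "2 * k \<le> l" and W: "card (W - {z}) \<ge> k + 1" "card (W - {z}) \<ge> 3"
    and light: "\<And>j. i \<le> j \<Longrightarrow> j < i + 2 * int k \<Longrightarrow> light_edge z j" "k = 1 \<Longrightarrow> light_edge z (i + 2)"
  shows "blue_cycle (2 * k + 1)"
proof (rule ccontr)
  assume no: "\<not> blue_cycle (2 * k + 1)"
  \<comment> \<open>The common exception \<open>z\<close> allows a chain from \<open>x\<close> to
    \<open>y\<close>, which a blue \<open>{v j, x, y}\<close> would close.\<close>
  have closing_red: "red {v j, x, y}"
    if Cs: "length Cs = k" "connectors Cs J" "\<forall>C\<in>set Cs. snd C = z"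
      and J: "J \<subseteq> {j<..<j + 2 * int l}" and xy: "x \<in> W - {z}" "y \<in> W - {z}" "x \<noteq> y" for Cs J j x y
  proof (rule ccontr)
    assume blue: "blue {v j, x, y}"
    have "card (W - {z} - {x, y}) = card (W - {z}) - card {x, y}"
      by (rule card_Diff_subset) (use xy in auto)
    then have "k - 1 \<le> card (W - {z} - {x, y})" using W(1) xy(3) by simp
    then obtain us where us: "distinct us" "set us \<subseteq> W - {z} - {x, y}" "length us = k - 1"
      using ex_distinct_list[of "W - {z} - {x, y}" "k - 1"] finite_W by blast
    have J': "J \<subseteq> {j..<j + 2 * int l}" using J by auto
    have ch: "chain Cs (x # us @ [y]) J"
      by (rule chain_constant[OF Cs(2) inj_on_v_subset[OF J'] Cs(3)]) (use us xy Cs(1) k in auto)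
    have "v j \<notin> v ` J" by (rule v_notin_image[OF _ J']) (use J len2 in auto)
    then have "blue_cycle (2 * k + 1)"
      using blue Cs(1) v_notin_chain[OF ch, of j]
      by (intro close_chain[OF ch, of "[v j]"]) (auto simp: insert_commute simp del: image_iff)
    then show False using no by simp
  qed
  obtain Cs where Cs: "length Cs = k" "connectors Cs {2 * i<..<2 * i + 4 * int k}" "\<forall>C\<in>set Cs. snd C = z"
    using connectors_light[of i k z] light by blast
  \<comment> \<open>Starting one edge later frees the joint \<open>2 * i + 2\<close>. For
    \<open>k > 1\<close> one light edge remains for the last connector and suffices by itself. For
    \<open>k = 1\<close> that edge contains the joint, and the light edge \<open>i + 2\<close> is
    used as well.\<close>
  have "\<exists>Ds. length Ds = k \<and> connectors Ds {2 * i + 2<..<2 * i + 2 + 2 * int l} \<and> (\<forall>C\<in>set Ds. snd C = z)"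
  proof (cases "k = 1")
    case True
    have "\<exists>Ds. length Ds = k \<and> connectors Ds {2 * (i + 1)<..<2 * (i + 1) + 4 * int k} \<and> (\<forall>C\<in>set Ds. snd C = z)"
    proof (rule connectors_light)
      fix j assume "i + 1 \<le> j" "j < i + 1 + 2 * int k"
      then have "j = i + 1 \<or> j = i + 2" using True by auto
      then show "light_edge z j" using light True by auto
    qed
    moreover have "{2 * (i + 1)<..<2 * (i + 1) + 4 * int k} \<subseteq> {2 * i + 2<..<2 * i + 2 + 2 * int l}"
      using True len2 by auto
    ultimately show ?thesis using connectors_mono by blast
  next
    case False
    have "\<exists>Ds. length Ds = k - 1 \<and> connectors Ds {2 * (i + 1)<..<2 * (i + 1) + 4 * int (k - 1)} \<and> (\<forall>C\<in>set Ds. snd C = z)"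
      by (rule connectors_light) (use light k in auto)
    then obtain Ds where Ds: "length Ds = k - 1" "connectors Ds {2 * (i + 1)<..<2 * (i + 1) + 4 * int (k - 1)}"
      "\<forall>C\<in>set Ds. snd C = z" by blast
    define j where "j = i + 2 * int k - 1"
    have "light_edge z j" using light k by (auto simp: j_def)
    then have "connectors (({2 * j..2 * j + 2}, z) # Ds) ({2 * j..2 * j + 2} \<union> {2 * (i + 1)<..<2 * (i + 1) + 4 * int (k - 1)})"
      by (intro connectors_Cons[OF connector_light_edge Ds(2)]) (use k in \<open>auto simp: j_def\<close>)
    then have "connectors (({2 * j..2 * j + 2}, z) # Ds) {2 * i + 2<..<2 * i + 2 + 2 * int l}"
      by (rule connectors_mono) (use k False in \<open>auto simp: j_def\<close>)
    then show ?thesis using Ds k by (intro exI[of _ "({2 * j..2 * j + 2}, z) # Ds"]) auto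
  qed
  then obtain Ds where Ds: "length Ds = k" "connectors Ds {2 * i + 2<..<2 * i + 2 + 2 * int l}" "\<forall>C\<in>set Ds. snd C = z"
    by blast
  obtain us where us: "distinct us" "set us \<subseteq> W - {z}" "length us = 3"
    using ex_distinct_list[OF _ W(2)] finite_W by blast
  then obtain x y w where xyw: "{x, y, w} \<subseteq> W - {z}" "distinct [x, y, w]"
    by (auto simp: length_Suc_conv numeral_3_eq_3)
  have "red {v (2 * i), x, y}"
    by (rule closing_red[OF Cs]) (use xyw k in auto)
  moreover have "red {v (2 * i + 2), y, w}"
    by (rule closing_red[OF Ds]) (use xyw in auto)
  ultimately show False
    using xyw by (intro detour1[of x y w i]) (auto simp: insert_commute)
qed

text \<open>As \<open>y\<close> is the only witness, \<open>w'\<close> is blue with the right pair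
  of edge \<open>i\<close>; \<open>w\<close> is blue with the left pair by
  \<open>reds_crossing\<close>, and \<open>blue_witness\<close> gives the third edge.\<close>

lemma triangle_left_witness:
  assumes light: "\<not> right_red i" and y: "y \<in> reds (v (2 * i + 1)) (v (2 * i + 2))" and W: "card W \<ge> 3"
  shows "blue_cycle 3"
proof -
  have "card (W - {y}) \<ge> 2" using W finite_W reds_W[OF y] by simp
  then obtain us where us: "distinct us" "set us \<subseteq> W - {y}" "length us = 2"
    using ex_distinct_list[of "W - {y}" 2] finite_W by blast
  then obtain w w' where ww: "w \<in> W" "w' \<in> W" "w \<noteq> y" "w' \<noteq> y" "w \<noteq> w'"
    by (auto simp: length_Suc_conv numeral_2_eq_2)
  have "w' \<notin> reds (v (2 * i + 1)) (v (2 * i + 2))"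
    using card_le_1D[OF _ finite_reds y, of w'] light ww(4) by (auto simp: right_red_def)
  moreover have "w \<notin> reds (v (2 * i)) (v (2 * i + 1))" using reds_crossing[OF _ y] ww by blast
  ultimately have b: "blue {v (2 * i), y, w'}" "blue {w', v (2 * i + 2), v (2 * i + 1)}" "blue {v (2 * i + 1), w, v (2 * i)}"
    using blue_witness[OF y, of w'] ww by (auto simp: reds_def insert_commute)
  show ?thesis unfolding blue_cycle_def closed_loose_path_def
    by (rule exI[of _ "[v (2 * i), y, w', v (2 * i + 2), v (2 * i + 1), w]"])
      (use b ww reds_W[OF y] in \<open>auto simp: v_neq_W v_neq4\<close>)
qed

text \<open>On \<open>a, b, c, d, e\<close> the exception can be chosen different from
  \<open>y\<close> unless \<open>{b, c, y}\<close> and \<open>{c, d, y}\<close> are both red. Then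
  \<open>reds_crossing\<close> leaves \<open>y\<close> as the only red extension in both
  edges.\<close>

lemma connectors_no_heavy:
  assumes no: "\<And>j. \<not> right_red j \<and> \<not> left_red j" and y: "y \<in> W"
  shows "\<exists>Cs. length Cs = n \<and> connectors Cs {2 * i<..<2 * i + 4 * int n} \<and>
    ((\<exists>C\<in>set Cs. snd C \<noteq> y) \<or> (\<forall>j. i \<le> j \<and> j < i + 2 * int n \<longrightarrow> light_edge y j))"
proof (induction n arbitrary: i)
  case 0
  then show ?case by (intro exI[of _ "[]"]) auto
next
  case (Suc n)
  from Suc.IH[of "i + 2"] obtain Cs where Cs: "length Cs = n" "connectors Cs {2 * (i + 2)<..<2 * (i + 2) + 4 * int n}"
    "(\<exists>C\<in>set Cs. snd C \<noteq> y) \<or> (\<forall>j. i + 2 \<le> j \<and> j < i + 2 + 2 * int n \<longrightarrow> light_edge y j)" by blast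
  let ?I = "{2 * i + 1..2 * i + 3}"
  have "\<exists>x. connector ?I x \<and> (x \<noteq> y \<or> light_edge y i \<and> light_edge y (i + 1))"
  proof (rule ccontr)
    assume *: "\<not> ?thesis"
    have e: "2 * (i + 1) = 2 * i + 2" "2 * i + 2 + 1 = 2 * i + 3" "2 * i + 2 + 2 = 2 * i + 4" by auto
    let ?X = "reds (v (2 * i + 1)) (v (2 * i + 2))" and ?Y = "reds (v (2 * i + 2)) (v (2 * i + 3))"
    have X1: "card ?X \<le> 1" and Y1: "card ?Y \<le> 1"
      using no[of i] no[of "i + 1"] unfolding right_red_def left_red_def e by auto
    have lk: "link ?I u w" if "u \<in> W" "w \<in> W" "u \<notin> ?X \<and> w \<notin> ?Y \<or> w \<notin> ?X \<and> u \<notin> ?Y" for u w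
      using that linkI[of "2 * i + 1" "2 * i + 2" "2 * i + 3" ?I u w] linkI[of "2 * i + 1" "2 * i + 2" "2 * i + 3" ?I w u]
      by (auto simp: v_neq4)
    have "y \<in> ?X \<and> y \<in> ?Y"
    proof (rule ccontr)
      assume ny: "\<not> (y \<in> ?X \<and> y \<in> ?Y)"
      have "\<exists>x. x \<noteq> y \<and> (\<forall>z. z \<in> ?X \<and> z \<in> ?Y \<longrightarrow> z = x)"
      proof (cases "\<exists>z. z \<in> ?X \<and> z \<in> ?Y")
        case True
        then obtain z where z: "z \<in> ?X" "z \<in> ?Y" by blast
        have "z' = z" if "z' \<in> ?X" for z' using card_le_1D[OF X1 finite_reds that z(1)] .
        moreover have "z \<noteq> y" using ny z by auto
        ultimately show ?thesis by blast
      next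
        case False
        \<comment> \<open>A default exception outside \<open>W\<close>, hence different from
          \<open>y\<close>.\<close>
        moreover have "v 0 \<noteq> y" using v_notin[of 0] y by auto
        ultimately show ?thesis by blast
      qed
      then obtain x where x: "x \<noteq> y" "\<And>z. z \<in> ?X \<Longrightarrow> z \<in> ?Y \<Longrightarrow> z = x" by blast
      have "connector ?I x"
        unfolding connector_def
      proof (intro ballI impI)
        fix u w assume uw: "u \<in> W - {x}" "w \<in> W - {x}" "u \<noteq> w"
        have "\<not> (u \<in> ?X \<and> w \<in> ?X)" "\<not> (u \<in> ?Y \<and> w \<in> ?Y)"
          using uw(3) card_le_1D[OF X1 finite_reds, of u w] card_le_1D[OF Y1 finite_reds, of u w] by auto
        moreover have "\<not> (u \<in> ?X \<and> u \<in> ?Y)" "\<not> (w \<in> ?X \<and> w \<in> ?Y)" using x(2)[of u] x(2)[of w] uw by auto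
        ultimately show "link ?I u w" using uw lk[of u w] by blast
      qed
      then show False using * x(1) by blast
    qed
    then have yX: "y \<in> ?X" and yY: "y \<in> ?Y" by auto
    have "?X \<subseteq> {y}" "?Y \<subseteq> {y}"
      using card_le_1D[OF X1 finite_reds _ yX] card_le_1D[OF Y1 finite_reds _ yY] by blast+
    moreover have "reds (v (2 * i)) (v (2 * i + 1)) \<subseteq> {y}" using reds_crossing[OF _ yX] by blast
    moreover have "reds (v (2 * i + 3)) (v (2 * i + 4)) \<subseteq> {y}"
      using reds_crossing[of y "i + 1"] yY unfolding e by blast
    ultimately have "light_edge y i" "light_edge y (i + 1)" unfolding light_edge_def e by simp_all
    then show False using * connector_light_edges by blast
  qed
  then obtain x where x: "connector ?I x" "x \<noteq> y \<or> light_edge y i \<and> light_edge y (i + 1)" by blast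
  have "connectors ((?I, x) # Cs) (?I \<union> {2 * (i + 2)<..<2 * (i + 2) + 4 * int n})"
    by (rule connectors_Cons[OF x(1) Cs(2)]) auto
  then have *: "connectors ((?I, x) # Cs) {2 * i<..<2 * i + 4 * int (Suc n)}"
    by (rule connectors_mono) auto
  have "light_edge y j" if h: "light_edge y i" "light_edge y (i + 1)" "\<forall>j. i + 2 \<le> j \<and> j < i + 2 + 2 * int n \<longrightarrow> light_edge y j"
    "i \<le> j" "j < i + 2 * int (Suc n)" for j
  proof -
    consider "j = i" | "j = i + 1" | "i + 2 \<le> j" using h(4) by linarith
    then show ?thesis
    proof cases
      case 3
      moreover have "j < i + 2 + 2 * int n" using h(5) by simp
      ultimately show ?thesis using h(3) by blast
    qed (use h(1,2) in simp_all)
  qed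
  then have "x \<noteq> y \<or> (\<exists>C\<in>set Cs. snd C \<noteq> y) \<or> (\<forall>j. i \<le> j \<and> j < i + 2 * int (Suc n) \<longrightarrow> light_edge y j)"
    using x(2) Cs(3) by blast
  then show ?case using * Cs(1) by (intro exI[of _ "(?I, x) # Cs"] conjI) auto
qed

text \<open>If some connector has an exception other than \<open>y\<close>, the chain can start at
  \<open>y\<close> and is closed by \<open>blue_witness\<close>. Otherwise all edges involved are
  light for \<open>y\<close>.\<close>

lemma odd_cycle_left_witness:
  assumes k: "k \<ge> 1" "2 * k \<le> l" and W: "card W \<ge> k + 2"
    and no: "\<And>j. \<not> right_red j \<and> \<not> left_red j" and y: "y \<in> reds (v (2 * i + 1)) (v (2 * i + 2))"
  shows "blue_cycle (2 * k + 1)"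
\<comment> \<open>For \<open>k = 1\<close> only two vertices of \<open>W - {y}\<close> are
  guaranteed, too few for \<open>odd_cycle_light\<close>.\<close>
proof (cases "k = 1")
  case True
  then show ?thesis using triangle_left_witness[OF _ y] no W by auto
next
  case False
  note yW = reds_W[OF y]
  let ?J = "{2 * i<..<2 * i + 4 * int k}"
  obtain Cs where Cs: "length Cs = k" "connectors Cs ?J"
    "(\<exists>C\<in>set Cs. snd C \<noteq> y) \<or> (\<forall>j. i \<le> j \<and> j < i + 2 * int k \<longrightarrow> light_edge y j)"
    using connectors_no_heavy[OF no yW, of k i] by blast
  have J: "?J \<subseteq> {2 * i..<2 * i + 2 * int l}" using k by auto
  show ?thesis
  proof (cases "\<exists>C\<in>set Cs. snd C \<noteq> y")
    case True
    then obtain C where C: "C \<in> set Cs" "snd C \<noteq> y" by blast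
    have W': "card W \<ge> length Cs + 2" using W Cs(1) by simp
    obtain Ds ws where ch: "chain Ds ws ?J" "hd ws = y" "length Ds = length Cs"
      by (rule ex_chain_from[OF Cs(2) inj_on_v_subset[OF J] W' yW C])
    have "Ds \<noteq> []" using ch(3) Cs(1) k by auto
    then have "last ws \<noteq> y" using last_neq_hd_chain[OF ch(1)] ch(2) by simp
    then have "blue {v (2 * i), y, last ws}"
      using blue_witness[OF y, of "last ws"] chain_ends[OF ch(1)] by simp
    then have "blue {last ws, v (2 * i), hd ws}" by (simp add: insert_commute ch(2))
    moreover have "v (2 * i) \<notin> v ` ?J" by (rule v_notin_image[OF _ J]) (use len2 in auto)
    ultimately show ?thesis
      using ch(3) Cs(1) by (intro close_chain[OF ch(1), of "[v (2 * i)]"]) (auto simp: v_notin_chain[OF ch(1)] simp del: image_iff)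
  next
    case False
    then have "light_edge y j" if "i \<le> j" "j < i + 2 * int k" for j using Cs(3) that by blast
    then show ?thesis
      using W yW finite_W \<open>k \<noteq> 1\<close> k by (intro odd_cycle_light[OF k, of y i]) auto
  qed
qed

lemma odd_cycle_no_heavy:
  assumes k: "k \<ge> 1" "2 * k \<le> l" and W: "card W \<ge> k + 2" and no: "\<And>j. \<not> right_red j \<and> \<not> left_red j"
  shows "blue_cycle (2 * k + 1)"
proof -
  interpret rev: red_cycle red "\<lambda>i. v (- i)" l W by (rule reverse)
  consider i y where "y \<in> reds (v (2 * i + 1)) (v (2 * i + 2))" | i y where "y \<in> reds (v (2 * i)) (v (2 * i + 1))"
    | "\<And>i. reds (v (2 * i)) (v (2 * i + 1)) = {} \<and> reds (v (2 * i + 1)) (v (2 * i + 2)) = {}" by blast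
  then show ?thesis
  proof cases
    case 1
    then show ?thesis using odd_cycle_left_witness[OF k W no] by blast
  next
    case (2 i y)
    have "2 * i = - (2 * (- i - 1) + 2)" "2 * i + 1 = - (2 * (- i - 1) + 1)" by auto
    then have y: "y \<in> reds (v (- (2 * (- i - 1) + 1))) (v (- (2 * (- i - 1) + 2)))"
      using 2 by (metis reds_commute)
    have "\<not> rev.right_red j \<and> \<not> rev.left_red j" for j
      using no by (simp add: reverse_right_red reverse_left_red)
    from rev.odd_cycle_left_witness[OF k W this y] show ?thesis by (rule reverse_blue_cycle)
  next
    case 3
    have "W - {v 0} = W" using v_notin by auto
    moreover have "light_edge (v 0) j" for j using 3[of j] by (simp add: light_edge_def)
    ultimately show ?thesis using W k by (intro odd_cycle_light[OF k, of "v 0" 0]) auto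
  qed
qed

lemma odd_cycle_from_left_red:
  assumes Cs: "connectors Cs J" "inj_on v J" "Cs \<noteq> []" and W: "card W \<ge> length Cs + 2"
    and i: "left_red i" and J: "v (2 * i + 2) \<notin> v ` J"
  shows "blue_cycle (2 * length Cs + 1)"
proof -
  interpret rev: red_cycle red "\<lambda>i. v (- i)" l W by (rule reverse)
  let ?Ds = "map (map_prod (image uminus) id) Cs"
  have "rev.connectors ?Ds (uminus ` J)"
    using rev.reverse_connectors[of Cs J] Cs(1) by simp
  moreover have "inj_on (\<lambda>i. v (- i)) (uminus ` J)"
    using Cs(2) by (auto simp: inj_on_def)
  moreover have "?Ds \<noteq> []" "length ?Ds + 2 \<le> card W" using W Cs(3) by auto
  moreover have "rev.right_red (- i - 1)" using i by (simp add: reverse_right_red)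
  moreover have "v (- (2 * (- i - 1))) \<notin> (\<lambda>i. v (- i)) ` uminus ` J"
    using J by (simp add: image_image algebra_simps)
  ultimately have "rev.blue_cycle (2 * length ?Ds + 1)"
    by (rule rev.odd_cycle_from_right_red)
  then show ?thesis using reverse_blue_cycle by simp
qed

section \<open>The critical case \<open>l = 2 * k\<close>, in which the pairs fill the whole
  cycle\<close>

lemma v_periodic_mult: "v (i + 2 * int l * m) = v i"
  by (simp add: v_eq_iff)

lemma heavy_periodic:
  "right_red (i + int l * m) = right_red i" "left_red (i + int l * m) = left_red i"
proof -
  have "2 * (i + int l * m) = 2 * i + 2 * int l * m" "2 * (i + int l * m) + 1 = (2 * i + 1) + 2 * int l * m"
    "2 * (i + int l * m) + 2 = (2 * i + 2) + 2 * int l * m" by (simp_all add: algebra_simps)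
  then show "right_red (i + int l * m) = right_red i" "left_red (i + int l * m) = left_red i"
    unfolding right_red_def left_red_def by (simp_all only: v_periodic_mult)
qed

lemma linked_periodic: "linked (i + int l * m) = linked i"
proof -
  have "i + int l * m + 1 = i + 1 + int l * m" by simp
  then show ?thesis unfolding linked_def by (simp only: heavy_periodic)
qed

lemma stuck_periodic: "stuck (i + int l * m) = stuck i"
proof -
  have "i + int l * m + 1 = i + 1 + int l * m" by simp
  moreover have "2 * (i + int l * m) = 2 * i + 2 * int l * m" "2 * i + 2 * int l * m + 1 = (2 * i + 1) + 2 * int l * m"
    "2 * i + 2 * int l * m + 3 = (2 * i + 3) + 2 * int l * m" by (simp_all add: algebra_simps)
  ultimately show ?thesis unfolding stuck_def by (simp only: heavy_periodic v_periodic_mult)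
qed

text \<open>Both ends of the window of \<open>k\<close> pairs from edge \<open>j\<close> are the
  joint \<open>v (2 * j)\<close>. The scans start from the linked pair, \<open>ends\<close> keeps
  this joint free, and the red pair next to it closes the chain.\<close>

lemma odd_cycle_cut:
  assumes k: "l = 2 * k" and W: "card W \<ge> k + 2"
    and linked: "linked (j + 2 * d)" and ends: "\<not> stuck_reverse j" "\<not> stuck (j - 2)"
    and j: "right_red j \<or> left_red (j - 1)"
  shows "blue_cycle (2 * k + 1)"
proof -
  have k0: "k > 0" using k len2 by simp
  \<comment> \<open>Reducing \<open>d\<close> modulo \<open>k\<close> moves the linked pair into the
    window by multiples of the period \<open>l = 2 * k\<close>.\<close>
  define s where "s = nat (d mod int k)"
  have s: "s < k" "int s = d mod int k" using k0 by (simp_all add: s_def nat_less_iff)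
  have "int l * (d div int k) = 2 * (int k * (d div int k))" using k by simp
  moreover have "d = int k * (d div int k) + d mod int k" by simp
  ultimately have "j + 2 * int s + int l * (d div int k) = j + 2 * d" using s(2) by linarith
  then have "linked (j + 2 * int s)" using linked linked_periodic by metis
  moreover have "j + 2 * int k - 2 = j - 2 + int l * 1" using k by simp
  then have "\<not> stuck (j + 2 * int k - 2)" using ends(2) stuck_periodic by metis
  ultimately obtain Cs where Cs: "length Cs = k" "connectors Cs {2 * j<..<2 * j + 4 * int k}"
    using ex_connectors_cut[of k s j] s(1) ends(1) k by auto
  let ?J = "{2 * j<..<2 * j + 4 * int k}"
  have J: "?J \<subseteq> {2 * j..<2 * j + 2 * int l}" using k by auto
  have n: "v (2 * j) \<notin> v ` ?J" "v (2 * (j - 1) + 2) \<notin> v ` ?J"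
    using v_notin_image[OF _ J, of "2 * j"] len2 by auto
  have "Cs \<noteq> []" "card W \<ge> length Cs + 2" using Cs(1) k0 W by auto
  then have "blue_cycle (2 * length Cs + 1)"
    using j odd_cycle_from_right_red[OF Cs(2) inj_on_v_subset[OF J] _ _ _ n(1)]
      odd_cycle_from_left_red[OF Cs(2) inj_on_v_subset[OF J] _ _ _ n(2)] by blast
  then show ?thesis using Cs(1) by simp
qed

text \<open>By \<open>stuckD\<close> the pair \<open>{b, e}\<close> is blue with all of
  \<open>W\<close>, while the mirrored condition asks for three red triples on it.\<close>

lemma stuck_not_reverse: "stuck i \<Longrightarrow> \<not> stuck_reverse i"
proof
  interpret rev: red_cycle red "\<lambda>i. v (- i)" l W by (rule reverse)
  assume "stuck i" "stuck_reverse i"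
  have "- (2 * (- i - 2)) = 2 * i + 4" "- (2 * (- i - 2) + 3) = 2 * i + 1" by auto
  with \<open>stuck_reverse i\<close> have "3 \<le> card (reds (v (2 * i + 4)) (v (2 * i + 1)))" unfolding rev.stuck_def by metis
  then show False using stuckD[OF \<open>stuck i\<close>] by (simp add: reds_commute)
qed

text \<open>Stepping back from \<open>i\<close> by two edges, a linked pair is met, so some pair is
  not stuck. The cycle is cut just before the first of these: \<open>j\<close> is stuck, hence right
  red, and \<open>j - 2\<close> is not stuck.\<close>

lemma odd_cycle_stuck:
  assumes k: "l = 2 * k" and W: "card W \<ge> k + 2" and i: "stuck i" and linked: "linked (i + 2 * d)"
  shows "blue_cycle (2 * k + 1)"
proof -
  have k0: "k > 0" using k len2 by simp
  \<comment> \<open>The summand \<open>int k * \<bar>d\<bar>\<close> makes the number of steps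
    nonnegative; doubled, it is a multiple of the period.\<close>
  define n where "n = nat (int k * \<bar>d\<bar> - d)"
  have "\<bar>d\<bar> * 1 \<le> \<bar>d\<bar> * int k" using k0 by (intro mult_left_mono) auto
  then have "d \<le> int k * \<bar>d\<bar>" unfolding mult.commute[of "int k"] by linarith
  then have "int n = int k * \<bar>d\<bar> - d" by (simp add: n_def)
  then have "i - 2 * int n + int l * \<bar>d\<bar> = i + 2 * d" using k by (simp add: algebra_simps)
  then have "linked (i - 2 * int n)" using linked linked_periodic by metis
  then have "\<not> stuck (i - 2 * int n)" using stuck_not_linked by blast
  then have "\<exists>n. \<not> stuck (i - 2 * int n) \<and> (\<forall>m<n. stuck (i - 2 * int m))"
    using exists_least_iff[of "\<lambda>n. \<not> stuck (i - 2 * int n)"] by auto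
  then obtain m where m: "\<not> stuck (i - 2 * int m)" "\<forall>q<m. stuck (i - 2 * int q)" by blast
  have "m \<noteq> 0" using m(1) i by (intro notI) simp
  then obtain q where q: "m = Suc q" by (cases m) auto
  define j where "j = i - 2 * int q"
  have eq: "j - 2 = i - 2 * int m" by (simp add: j_def q)
  have j: "stuck j" "\<not> stuck (j - 2)" unfolding eq using m q by (auto simp: j_def)
  have "linked (j + 2 * (d + int q))" using linked by (simp add: j_def)
  from odd_cycle_cut[OF k W this stuck_not_reverse[OF j(1)] j(2)] j(1) show ?thesis
    by (simp add: stuck_def)
qed

lemma odd_cycle_linked:
  assumes k: "l = 2 * k" and W: "card W \<ge> k + 2" and linked: "linked (j + 2 * d)"
    and j: "right_red j \<or> left_red (j - 1)"
  shows "blue_cycle (2 * k + 1)"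
proof -
  interpret rev: red_cycle red "\<lambda>i. v (- i)" l W by (rule reverse)
  consider e where "stuck (j + 2 * e)" | e where "stuck_reverse (j + 2 * e)"
    | "\<And>e. \<not> stuck (j + 2 * e) \<and> \<not> stuck_reverse (j + 2 * e)" by blast
  then show ?thesis
  proof cases
    case (1 e)
    have "linked (j + 2 * e + 2 * (d - e))" using linked by simp
    then show ?thesis by (rule odd_cycle_stuck[OF k W 1])
  next
    case (2 e)
    have "rev.linked (- (j + 2 * e) - 2 + 2 * (e - d))" using linked by (simp add: reverse_linked)
    from rev.odd_cycle_stuck[OF k W 2 this] show ?thesis by (rule reverse_blue_cycle)
  next
    case 3
    then show ?thesis using odd_cycle_cut[OF k W linked _ _ j] 3[of 0] 3[of "- 1"] by simp
  qed
qed

text \<open>Here every connector needs the joint at which an odd cycle would be closed. Two failed attempts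
  to close elsewhere yield the red detour \<open>{a, s, z}, {z, u0, d}, {d, u, e}\<close>.\<close>

lemma odd_cycle_alternating:
  assumes k: "l = 2 * k" "k \<ge> 2" and W: "card W \<ge> k + 2" and i: "right_red (i + 1)"
    and alt: "\<And>e. \<not> right_red (i + 2 * e) \<and> \<not> left_red (i + 2 * e - 1)"
  shows "blue_cycle (2 * k + 1)"
proof (rule ccontr)
  assume no: "\<not> blue_cycle (2 * k + 1)"
  have linked: "linked (i + 2 * e)" for e
    using alt[of e] alt[of "e + 1"] by (auto simp: linked_def algebra_simps)
  define J where "J = {2 * i + 4<..<2 * i + 4 * int k}"
  obtain Cs where Cs: "length Cs = k - 1" "connectors Cs J"
  proof -
    have "2 * (k - 1) \<le> l" using k by simp
    then obtain Cs where Cs: "length Cs = k - 1" "connectors Cs {m \<in> {2 * (i + 2)..2 * (i + 2) + 4 * int (k - 1)}.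
        (m = 2 * (i + 2) \<longrightarrow> \<not> linked (i + 2)) \<and>
        (m = 2 * (i + 2) + 4 * int (k - 1) \<longrightarrow> stuck (i + 2 + 2 * int (k - 1) - 2))}"
      using ex_connectors[of "k - 1" "i + 2"] by blast
    have "i + 2 + 2 * int (k - 1) - 2 = i + 2 * int (k - 1)" by simp
    then have "\<not> stuck (i + 2 + 2 * int (k - 1) - 2)" using linked stuck_not_linked by metis
    then have "connectors Cs J"
      using linked[of 1] k by (intro connectors_mono[OF Cs(2)]) (auto simp: J_def of_nat_diff)
    then show ?thesis using that Cs(1) by blast
  qed
  have J: "J \<subseteq> {2 * i..<2 * i + 2 * int l}" using k by (auto simp: J_def)
  have vJ: "v j \<notin> v ` J" if "j \<in> {2 * i..2 * i + 4}" for j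
    by (rule v_notin_image[OF _ J]) (use that k in \<open>auto simp: J_def\<close>)
  have e: "2 * (i + 1) = 2 * i + 2" "2 * i + 2 + 1 = 2 * i + 3" "2 * i + 2 + 2 = 2 * i + 4" by auto
  obtain u where u: "u \<in> reds (v (2 * i + 3)) (v (2 * i + 4))" "u \<noteq> snd (hd Cs)"
    using i reds_avoiding unfolding right_red_def e by blast
  note uW = reds_W[OF u(1)]
  obtain ws where ch: "chain Cs ws J" "hd ws = u"
    by (rule ex_chain[OF Cs(2) inj_on_v_subset[OF J] _ uW]) (use W Cs(1) u(2) in auto)
  have ne: "Cs \<noteq> []" using Cs(1) k by auto
  then have z: "last ws \<noteq> u" using last_neq_hd_chain[OF ch(1)] ch(2) by simp
  define z where "z = last ws"
  have zW: "z \<in> W" "z \<in> set ws" "u \<in> set ws" using chain_ends[OF ch(1)] ch(2) by (auto simp: z_def)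
  have "card (W - set ws) \<ge> 2"
    using card_chain[OF ch(1)] W Cs(1) k ch(1) by (subst card_Diff_subset) (auto simp: chain_def)
  moreover have "card (reds (v (2 * i + 1)) (v (2 * i + 2))) \<le> 1" using alt[of 0] by (simp add: right_red_def)
  ultimately obtain u0 where u0: "u0 \<in> W - set ws" "u0 \<notin> reds (v (2 * i + 1)) (v (2 * i + 2))"
    by (rule_tac ex_avoiding[of "reds (v (2 * i + 1)) (v (2 * i + 2))" "W - set ws"]) auto
  obtain s where s: "s \<in> W - set ws" "s \<noteq> u0"
    using \<open>card (W - set ws) \<ge> 2\<close> by (rule_tac ex_avoiding[of "{u0}" "W - set ws"]) auto
  let ?I = "{2 * i + 1..2 * i + 3}"
  \<comment> \<open>Otherwise the link through \<open>{b, c, d}\<close>, which has no exception,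
    extends the chain to \<open>s\<close>, and this triple closes it.\<close>
  have red1: "red {v (2 * i), s, z}"
  proof (rule ccontr)
    assume blue: "blue {v (2 * i), s, z}"
    have "connector ?I u" using link_right_red[OF i] by (simp add: connector_def)
    then have con: "connectors ((?I, u) # Cs) (?I \<union> J)" by (rule connectors_Cons[OF _ Cs(2)]) (auto simp: J_def)
    have IJ: "?I \<union> J \<subseteq> {2 * i..<2 * i + 2 * int l}" using J k by auto
    have "ws = u # tl ws" using ch chain_nonempty[OF ch(1)] by (cases ws) auto
    have "chain ((?I, u) # Cs) (s # ws) (?I \<union> J)"
      unfolding chain_def
    proof (intro conjI allI impI)
      fix q assume "q < length ((?I, u) # Cs)"
      then show "link (fst (((?I, u) # Cs) ! q)) ((s # ws) ! q) ((s # ws) ! Suc q)"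
        using ch link_right_red[OF i, of s u] s uW hd_conv_nth[OF chain_nonempty[OF ch(1)]]
        by (cases q) (auto simp: chain_def)
    qed (use con inj_on_v_subset[OF IJ] ch(1) s in \<open>auto simp: chain_def\<close>)
    moreover have "v (2 * i) \<notin> v ` (?I \<union> J)"
      by (rule v_notin_image[OF _ IJ]) (use len2 in \<open>auto simp: J_def\<close>)
    ultimately have "blue_cycle (2 * k + 1)"
      using blue Cs(1) k v_notin_chain[of "(?I, u) # Cs" "s # ws" "?I \<union> J" "2 * i"] chain_nonempty[OF ch(1)]
      by (intro close_chain[of "(?I, u) # Cs" "s # ws" "?I \<union> J" "[v (2 * i)]"])
        (auto simp: insert_commute z_def simp del: image_iff)
    then show False using no by simp
  qed
  \<comment> \<open>Otherwise the edges \<open>{z, d, u0}\<close>, \<open>{u0, b, c}\<close>,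
    \<open>{c, s, u}\<close> close the chain of \<open>k - 1\<close> connectors.\<close>
  have red2: "red {v (2 * i + 3), u0, z}"
  proof (rule ccontr)
    assume blue: "blue {v (2 * i + 3), u0, z}"
    have "blue {u0, v (2 * i + 1), v (2 * i + 2)}" using u0 by (simp add: reds_def insert_commute)
    moreover have "s \<noteq> u" using s zW by auto
    then have "blue {v (2 * i + 2), s, u}"
      using blue_witness[of u "i + 1" s] u s unfolding e by (simp add: insert_commute)
    ultimately have "blue_cycle (2 * k + 1)"
      using blue Cs(1) k s u0 vJ ch(2)
      by (intro close_chain[OF ch(1), of "[v (2 * i + 3), u0, v (2 * i + 1), v (2 * i + 2), s]"])
        (auto simp: insert_commute z_def v_notin_chain[OF ch(1)] v_neq_W v_neq4 v_image_notin simp del: image_iff)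
    then show False using no by simp
  qed
  have "red {v (2 * i + 3), u, v (2 * i + 4)}" using reds_D[OF u(1)] by simp
  then show False
    using red1 red2 s u0 zW uW z
    by (intro detour2[of s z u0 "v (2 * i + 3)" u i]) (auto simp: insert_commute v_neq_W z_def)
qed

text \<open>If blue, \<open>{x, v (2 * i + 3), y}\<close> completes a blue triangle. If red, it
  forms a red one with \<open>{v (2 * i + 2), v (2 * i + 1), y}\<close> and edge
  \<open>i + 1\<close>, against \<open>no_longer\<close>.\<close>

lemma triangle_right_red:
  assumes l: "l = 2" and W: "card W \<ge> 3" and i: "right_red i"
  shows "blue_cycle 3"
proof (rule ccontr)
  assume no: "\<not> blue_cycle 3"
  let ?S = "reds (v (2 * i + 1)) (v (2 * i + 2))"
  obtain y where y: "y \<in> ?S" using i by (auto simp: right_red_def intro: reds_avoiding)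
  obtain y' where y': "y' \<in> ?S" "y' \<noteq> y" using i reds_avoiding unfolding right_red_def by blast
  have "card {y, y'} < card W" using W by (auto simp: card_insert_if)
  then obtain x where x: "x \<in> W" "x \<noteq> y" "x \<noteq> y'" using ex_avoiding[of "{y, y'}" W] by auto
  note yW = reds_W[OF y] reds_W[OF y'(1)]
  have "x \<notin> reds (v (2 * i)) (v (2 * i + 1))" using right_redD[OF i] by simp
  then have b: "blue {v (2 * i), v (2 * i + 1), x}" "blue {y, y', v (2 * i)}"
    using x blue_witness[OF y, of y'] y' yW by (auto simp: reds_def insert_commute)
  have 1: "red {x, v (2 * i + 3), y}"
  proof (rule ccontr)
    assume "blue {x, v (2 * i + 3), y}"
    then have "blue_cycle 3" unfolding blue_cycle_def closed_loose_path_def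
      by (intro exI[of _ "[v (2 * i), v (2 * i + 1), x, v (2 * i + 3), y, y']"])
        (use b x y'(2) yW in \<open>auto simp: v_neq_W v_neq4\<close>)
    then show False using no by simp
  qed
  have "v (2 * i + 4) = v (2 * i)" using v_periodic[of "2 * i"] l by simp
  moreover have e: "2 * (i + 1) = 2 * i + 2" "2 * i + 2 + 1 = 2 * i + 3" "2 * i + 2 + 2 = 2 * i + 4" by auto
  ultimately have 2: "red {v (2 * i + 3), v (2 * i), v (2 * i + 2)}"
    using red_edge[of "i + 1"] unfolding e by (simp add: insert_commute)
  have "closed_loose_path red [v (2 * i + 2), v (2 * i + 1), y, x, v (2 * i + 3), v (2 * i)]"
    unfolding closed_loose_path_def using 1 2 reds_D[OF y] x yW by (auto simp: v_neq_W v_neq4 insert_commute)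
  then show False
    using no_longer[of "[v (2 * i + 2), v (2 * i + 1), y, x, v (2 * i + 3), v (2 * i)]"] l x yW by auto
qed

text \<open>For \<open>l > 2 * k\<close> an edge can be left out. For \<open>l = 2 * k\<close> and
  \<open>k > 1\<close> a linked pair \<open>i + 2 * d\<close> allows a cut. If there is none, no
  edge \<open>i + 2 * e\<close> is left red and no edge \<open>i + 2 * e + 1\<close> is right red,
  as in \<open>odd_cycle_alternating\<close>.\<close>

lemma odd_cycle_right_red:
  assumes k: "k \<ge> 1" "2 * k \<le> l" and W: "card W \<ge> k + 2" and i: "right_red i"
  shows "blue_cycle (2 * k + 1)"
proof (cases "l = 2 * k")
  case False
  then have "2 * k + 1 \<le> l" using k by simp
  then obtain j Cs where j: "right_red j" and Cs: "length Cs = k" "connectors Cs {2 * j + 2..<2 * j + 2 * int l}"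
    using ex_connectors_beside[of k right_red i] i by blast
  have J: "{2 * j + 2..<2 * j + 2 * int l} \<subseteq> {2 * j..<2 * j + 2 * int l}" by auto
  have "v (2 * j) \<notin> v ` {2 * j + 2..<2 * j + 2 * int l}" by (rule v_notin_image[OF _ J]) (use len2 in auto)
  moreover have "Cs \<noteq> []" using Cs(1) k by auto
  ultimately have "blue_cycle (2 * length Cs + 1)"
    using Cs(1) W j by (intro odd_cycle_from_right_red[OF Cs(2) inj_on_v_subset[OF J]]) auto
  then show ?thesis using Cs(1) by simp
next
  case True
  show ?thesis
  proof (cases "k = 1")
    case k1: True
    then show ?thesis using triangle_right_red[OF _ _ i] True W by simp
  next
    case False
    show ?thesis
    proof (cases "\<exists>d. linked (i + 2 * d)")
      case linked: True
      then show ?thesis using odd_cycle_linked[OF True W] i by blast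
    next
      case no: False
      have "\<not> right_red (i - 1 + 2 * e) \<and> \<not> left_red (i - 1 + 2 * e - 1)" for e
      proof -
        have "\<not> linked (i + 2 * (e - 1))" using no by blast
        moreover have "i + 2 * (e - 1) + 1 = i - 1 + 2 * e" "i + 2 * (e - 1) = i - 1 + 2 * e - 1" by auto
        ultimately show ?thesis unfolding linked_def by metis
      qed
      then show ?thesis using odd_cycle_alternating[OF True _ W, of "i - 1"] False k i by simp
    qed
  qed
qed

lemma odd_cycle:
  assumes k: "k \<ge> 1" "2 * k \<le> l" and W: "card W \<ge> k + 2"
  shows "blue_cycle (2 * k + 1)"
proof -
  interpret rev: red_cycle red "\<lambda>i. v (- i)" l W by (rule reverse)
  consider i where "right_red i" | i where "left_red i" | "\<And>i. \<not> right_red i \<and> \<not> left_red i" by blast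
  then show ?thesis
  proof cases
    case (2 i)
    then have "rev.right_red (- i - 1)" by (simp add: reverse_right_red)
    from rev.odd_cycle_right_red[OF k W this] show ?thesis by (rule reverse_blue_cycle)
  qed (use odd_cycle_right_red[OF k W] odd_cycle_no_heavy[OF k W] in blast)+
qed

lemma ex_blue_cycle:
  assumes m: "m \<ge> 3" "m \<le> l + 1" and W: "card W \<ge> 2 + (m - 1) div 2"
  shows "blue_cycle m"
proof (cases "even m")
  case True
  then obtain k where "m = 2 * k" by blast
  then show ?thesis using even_cycle[of k] m W by auto
next
  case False
  then obtain k where "m = 2 * k + 1" by (rule oddE)
  then show ?thesis using odd_cycle[of k] m W by auto
qed

end

definition has_cycle :: "('a set \<Rightarrow> bool) \<Rightarrow> 'a set \<Rightarrow> nat \<Rightarrow> bool" where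
  "has_cycle P V n \<longleftrightarrow> (\<exists>xs. closed_loose_path P xs \<and> length xs = 2 * n \<and> set xs \<subseteq> V)"

section \<open>The Ramsey number\<close>

lemma red_cycle_of_list:
  assumes xs: "closed_loose_path red xs" "length xs = 2 * l" and l: "l \<ge> 2"
    and W: "finite W" "set xs \<inter> W = {}" and no: "\<not> has_cycle red (set xs \<union> W) (l + 1)"
  shows "red_cycle red (\<lambda>i. xs ! nat (i mod (2 * int l))) l W"
proof
  let ?v = "\<lambda>i. xs ! nat (i mod (2 * int l))"
  have lt: "nat (i mod (2 * int l)) < length xs" for i
    using l xs(2) by (simp add: nat_less_iff)
  then have in_xs: "?v i \<in> set xs" for i using nth_mem by blast
  show "?v i = ?v j \<longleftrightarrow> 2 * int l dvd i - j" for i j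
  proof -
    have "?v i = ?v j \<longleftrightarrow> nat (i mod (2 * int l)) = nat (j mod (2 * int l))"
      using xs(1) lt by (intro nth_eq_iff_index_eq) (auto simp: closed_loose_path_def)
    also have "\<dots> \<longleftrightarrow> i mod (2 * int l) = j mod (2 * int l)"
      using l by (intro eq_nat_nat_iff) auto
    finally show ?thesis by (simp add: mod_eq_dvd_iff)
  qed
  show "?v i \<notin> W" for i using in_xs[of i] W(2) by auto
  show "red {?v (2 * i), ?v (2 * i + 1), ?v (2 * i + 2)}" for i
  proof -
    define q where "q = nat (i mod int l)"
    have q: "q < l" "int q = i mod int l" using l by (simp_all add: q_def nat_less_iff)
    have e: "2 * i mod (2 * int l) = int (2 * q)" using q(2) by simp
    have "(2 * i + 1) mod (2 * int l) = (2 * i mod (2 * int l) + 1) mod (2 * int l)" by (rule mod_add_left_eq[symmetric])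
    also have "\<dots> = int (2 * q + 1)" unfolding e using q(1) by simp
    finally have e1: "(2 * i + 1) mod (2 * int l) = int (2 * q + 1)" .
    have "(2 * i + 2) mod (2 * int l) = (2 * i mod (2 * int l) + 2) mod (2 * int l)" by (rule mod_add_left_eq[symmetric])
    also have "\<dots> = int ((2 * q + 2) mod (2 * l))" unfolding e by (simp add: zmod_int add.commute)
    finally have e2: "(2 * i + 2) mod (2 * int l) = int ((2 * q + 2) mod (2 * l))" .
    show ?thesis unfolding e e1 e2 nat_int by (rule closed_loose_path_nth[OF xs q(1)])
  qed
  show "\<not> (closed_loose_path red ys \<and> length ys = 2 * (l + 1) \<and> set ys \<subseteq> range ?v \<union> W)" for ys
  proof
    assume ys: "closed_loose_path red ys \<and> length ys = 2 * (l + 1) \<and> set ys \<subseteq> range ?v \<union> W"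
    have "range ?v \<subseteq> set xs" using in_xs by blast
    then have "set ys \<subseteq> set xs \<union> W" using ys by blast
    then show False using no ys unfolding has_cycle_def by blast
  qed
qed (use l W in auto)

lemma longer_cycle:
  assumes "has_cycle red V l" "l \<ge> 2" "finite V" "m \<ge> 3" "m \<le> l + 1" "card V \<ge> 2 * (l + 1) + (m - 1) div 2"
  shows "has_cycle red V (l + 1) \<or> has_cycle (\<lambda>e. \<not> red e) V m"
proof (rule ccontr)
  assume no: "\<not> ?thesis"
  obtain xs where xs: "closed_loose_path red xs" "length xs = 2 * l" "set xs \<subseteq> V"
    using assms(1) by (auto simp: has_cycle_def)
  let ?W = "V - set xs"
  have V: "set xs \<union> ?W = V" using xs(3) by auto
  interpret red_cycle red "\<lambda>i. xs ! nat (i mod (2 * int l))" l ?W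
    by (rule red_cycle_of_list[OF xs(1,2) assms(2)]) (use assms(3) no xs(3) in \<open>auto simp: Un_absorb1\<close>)
  have "card (set xs) = 2 * l" using xs(1,2) by (simp add: closed_loose_path_def distinct_card)
  then have "card ?W = card V - 2 * l" using xs(3) by (simp add: card_Diff_subset)
  then have "card ?W \<ge> 2 + (m - 1) div 2" using assms(6) by simp
  from ex_blue_cycle[OF assms(4,5) this] obtain ys where
    ys: "closed_loose_path (\<lambda>e. \<not> red e) ys" "length ys = 2 * m"
      "set ys \<subseteq> range (\<lambda>i. xs ! nat (i mod (2 * int l))) \<union> ?W"
    unfolding blue_cycle_def by blast
  have "nat (i mod (2 * int l)) < length xs" for i
    using assms(2) xs(2) by (simp add: nat_less_iff)
  then have "range (\<lambda>i. xs ! nat (i mod (2 * int l))) \<subseteq> set xs" using nth_mem by blast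
  then have "set ys \<subseteq> V" using ys(3) xs(3) by blast
  then show False using no ys unfolding has_cycle_def by blast
qed

text \<open>Any two of \<open>{a, b, c}\<close>, \<open>{a, c, d}\<close>, \<open>{a, b, d}\<close>
  form a cycle of length two, and two of the three have the same colour.\<close>

lemma has_cycle_2:
  assumes "finite V" "card V \<ge> 4"
  shows "has_cycle red V 2 \<or> has_cycle (\<lambda>e. \<not> red e) V 2"
proof -
  obtain us where us: "distinct us" "set us \<subseteq> V" "length us = 4"
    using ex_distinct_list[OF assms] by blast
  then obtain a b c d where abcd: "distinct [a, b, c, d]" "set [a, b, c, d] \<subseteq> V"
    by (auto simp: length_Suc_conv numeral_eq_Suc)
  have *: "has_cycle P V 2" if "P {w, x, y}" "P {y, z, w}" "distinct [w, x, y, z]" "set [w, x, y, z] \<subseteq> V" for P w x y z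
    using that unfolding has_cycle_def closed_loose_path_def by (intro exI[of _ "[w, x, y, z]"]) auto
  have **: "has_cycle P V 2" if "P {a, b, c} \<and> P {a, c, d} \<or> P {a, b, c} \<and> P {a, b, d} \<or> P {a, c, d} \<and> P {a, b, d}" for P
    using that
  proof (elim disjE conjE)
    assume "P {a, b, c}" "P {a, c, d}"
    then show ?thesis using *[of P a b c d] abcd by (auto simp: insert_commute)
  next
    assume "P {a, b, c}" "P {a, b, d}"
    then show ?thesis using *[of P a c b d] abcd by (auto simp: insert_commute)
  next
    assume "P {a, c, d}" "P {a, b, d}"
    then show ?thesis using *[of P a c d b] abcd by (auto simp: insert_commute)
  qed
  show ?thesis using **[of red] **[of "\<lambda>e. \<not> red e"] by blast
qed

text \<open>For \<open>m = Suc n\<close> the induction hypothesis is used with \<open>n\<close> for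
  \<open>m\<close>; it gives a cycle of length \<open>n\<close> in one of the colours, and
  \<open>longer_cycle\<close> applies to either.\<close>

lemma has_cycle_upper:
  assumes "finite V" "3 \<le> m" "m \<le> n" "card V \<ge> 2 * n + (m - 1) div 2"
  shows "has_cycle red V n \<or> has_cycle (\<lambda>e. \<not> red e) V m"
proof -
  have "3 \<le> n" using assms by simp
  then show ?thesis using assms(2-4)
  proof (induction n arbitrary: m rule: dec_induct)
    case base
    then have m: "m = 3" by simp
    have "card V \<ge> 4" using base by simp
    then show ?case
      using has_cycle_2[OF assms(1), of red] longer_cycle[of red V 2 3] longer_cycle[of "\<lambda>e. \<not> red e" V 2 3]
        base m assms(1) by auto
  next
    case (step n)
    show ?case
    proof (cases "m = Suc n")
      case False
      then have "has_cycle red V n \<or> has_cycle (\<lambda>e. \<not> red e) V m"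
        using step by (intro step.IH) auto
      then show ?thesis using longer_cycle[of red V n m] step.hyps step.prems assms(1) by auto
    next
      case True
      have "(n - 1) div 2 \<le> n" by simp
      then have "has_cycle red V n \<or> has_cycle (\<lambda>e. \<not> red e) V n"
        using step True by (intro step.IH) auto
      then show ?thesis
        using longer_cycle[of red V n m] longer_cycle[of "\<lambda>e. \<not> red e" V n m] step.hyps step.prems assms(1) True by auto
    qed
  qed
qed

lemma arrows3_upper:
  assumes "3 \<le> m" "m \<le> n" "N \<ge> 2 * n + (m - 1) div 2"
  shows "arrows3 N (loose_cycle n) (loose_cycle m)"
  unfolding arrows3_def
proof
  fix \<chi> :: "nat set \<Rightarrow> colour"
  have copy: "contains_copy (colour_class (complete3 N) \<chi> k) (loose_cycle j)"
    if "has_cycle (\<lambda>e. \<chi> e = k) {..<N} j" "j \<ge> 3" for k j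
    using that closed_loose_path_copy[of "\<lambda>e. \<chi> e = k" _ j "{..<N}"]
    by (auto simp: has_cycle_def colour_class_def complete3_def)
  have "(\<lambda>e. \<not> \<chi> e = Red) = (\<lambda>e. \<chi> e = Blue)" by (metis colour.distinct(1) colour.exhaust)
  then have "has_cycle (\<lambda>e. \<chi> e = Red) {..<N} n \<or> has_cycle (\<lambda>e. \<chi> e = Blue) {..<N} m"
    using has_cycle_upper[of "{..<N}" m n "\<lambda>e. \<chi> e = Red"] assms by simp
  then show "contains_copy (colour_class (complete3 N) \<chi> Red) (loose_cycle n) \<or>
    contains_copy (colour_class (complete3 N) \<chi> Blue) (loose_cycle m)"
    using copy assms by auto
qed

section \<open>Lower bound: incidences of the loose cycle and the extremal colouring\<close>

definition cycle_edge :: "nat \<Rightarrow> nat \<Rightarrow> nat set" where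
  "cycle_edge n i = {(2 * i + 1) mod (2 * n), (2 * i + 2) mod (2 * n), (2 * i + 3) mod (2 * n)}"

lemma edges_loose_cycle: "snd (loose_cycle n) = cycle_edge n ` {..<n}"
  unfolding loose_cycle_def cycle_edge_def snd_conv by blast

lemma fst_loose_cycle: "fst (loose_cycle n) = {..<2 * n}"
  by (simp add: loose_cycle_def)

lemma cycle_edge_last:
  assumes "n \<ge> 2"
  shows "cycle_edge n (n - 1) = {2 * n - 1, 0, 1}"
proof -
  have e: "2 * (n - 1) + 1 = 2 * n - 1" "2 * (n - 1) + 2 = 2 * n" "2 * (n - 1) + 3 = 1 + 2 * n"
    using assms by auto
  have "(1 + 2 * n) mod (2 * n) = 1" using assms by (subst mod_add_self2) simp
  then show ?thesis unfolding cycle_edge_def e using assms by simp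
qed

lemma cycle_edge_less: "Suc i < n \<Longrightarrow> cycle_edge n i = {2 * i + 1, 2 * i + 2, 2 * i + 3}"
  by (simp add: cycle_edge_def)

lemma vertex_in_cycle_edge:
  assumes "n \<ge> 2" "j < 2 * n"
  shows "\<exists>i<n. j \<in> cycle_edge n i"
proof (cases "j = 0 \<or> j = 2 * n - 1")
  case True
  then show ?thesis using assms cycle_edge_last[of n] by (intro exI[of _ "n - 1"]) auto
next
  case False
  define i where "i = (j - 1) div 2"
  have "j = 2 * i + 1 \<or> j = 2 * i + 2" using False unfolding i_def by presburger
  moreover have "Suc i < n" using False assms unfolding i_def by linarith
  ultimately show ?thesis using cycle_edge_less[of i n] by (intro exI[of _ i]) auto
qed

text \<open>The joint \<open>2 * i + 1\<close> lies in the edges \<open>i\<close> and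
  \<open>i - 1\<close>, the inner vertex \<open>2 * i + 2\<close> only in \<open>i\<close>. So the
  edge is \<open>x div 2\<close> or its cyclic predecessor.\<close>

lemma cycle_edge_vertex:
  assumes "n \<ge> 2" "i < n" "x \<in> cycle_edge n i"
  shows "i \<in> {x div 2, (x div 2 + (n - 1)) mod n}"
proof (cases "Suc i < n")
  case True
  then have "x = 2 * i + 1 \<or> x = 2 * i + 2 \<or> x = 2 * i + 3" using assms(3) by (auto simp: cycle_edge_less)
  then have "x div 2 = i \<or> x div 2 = i + 1" by auto
  moreover have "(i + 1 + (n - 1)) mod n = i" using assms by simp
  ultimately show ?thesis by auto
next
  case False
  then have i: "i = n - 1" using assms by simp
  have "x \<in> {2 * n - 1, 0, 1}" using assms(3) unfolding i cycle_edge_last[OF assms(1)] .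
  moreover have "(2 * n - 1) div 2 = n - 1" by simp
  ultimately show ?thesis using i assms(1) by auto
qed

lemma not_arrows3_lower:
  assumes "3 \<le> m" "m \<le> n" "N < 2 * n + (m - 1) div 2"
  shows "\<not> arrows3 N (loose_cycle n) (loose_cycle m)"
proof
  assume arrows: "arrows3 N (loose_cycle n) (loose_cycle m)"
  define \<chi> where "\<chi> e = (if e \<subseteq> {..<2 * n - 1} then Red else Blue)" for e :: "nat set"
  consider f where "inj_on f {..<2 * n}" "\<forall>i<n. f ` cycle_edge n i \<subseteq> {..<2 * n - 1}"
    | f where "inj_on f {..<2 * m}" "f ` {..<2 * m} \<subseteq> {..<N}" "\<forall>i<m. \<not> f ` cycle_edge m i \<subseteq> {..<2 * n - 1}"
  proof -
    have "contains_copy (colour_class (complete3 N) \<chi> Red) (loose_cycle n) \<or>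
      contains_copy (colour_class (complete3 N) \<chi> Blue) (loose_cycle m)"
      using arrows unfolding arrows3_def by blast
    then show thesis
    proof
      assume "contains_copy (colour_class (complete3 N) \<chi> Red) (loose_cycle n)"
      then obtain f where f: "inj_on f {..<2 * n}" "\<forall>i<n. \<chi> (f ` cycle_edge n i) = Red"
        by (auto simp: contains_copy_def colour_class_def complete3_def edges_loose_cycle fst_loose_cycle)
      have "f ` cycle_edge n i \<subseteq> {..<2 * n - 1}" if "i < n" for i
        using f(2) that unfolding \<chi>_def by (metis colour.distinct(1))
      then show thesis using that(1) f(1) by blast
    next
      assume "contains_copy (colour_class (complete3 N) \<chi> Blue) (loose_cycle m)"
      then obtain f where f: "inj_on f {..<2 * m}" "f ` {..<2 * m} \<subseteq> {..<N}" "\<forall>i<m. \<chi> (f ` cycle_edge m i) = Blue"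
        by (auto simp: contains_copy_def colour_class_def complete3_def edges_loose_cycle fst_loose_cycle)
      have "\<not> f ` cycle_edge m i \<subseteq> {..<2 * n - 1}" if "i < m" for i
        using f(3) that unfolding \<chi>_def by (metis colour.distinct(1))
      then show thesis using that(2) f(1,2) by blast
    qed
  qed
  then show False
  proof cases
    case (1 f)
    \<comment> \<open>Every vertex lies in an edge, so all \<open>2 * n\<close> vertices of a red
      cycle would be among \<open>2 * n - 1\<close>.\<close>
    have "f j < 2 * n - 1" if j: "j < 2 * n" for j
    proof -
      obtain i where "i < n" "j \<in> cycle_edge n i" using vertex_in_cycle_edge[of n j] j assms by auto
      then show ?thesis using 1(2) by blast
    qed
    then have "f ` {..<2 * n} \<subseteq> {..<2 * n - 1}" by auto
    then have "card (f ` {..<2 * n}) \<le> 2 * n - 1" by (metis card_lessThan card_mono finite_lessThan)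
    then show False using card_image[OF 1(1)] assms by simp
  next
    case (2 f)
    define X where "X = {x. x < 2 * m \<and> f x \<in> {2 * n - 1..<N}}"
    have "X \<subseteq> {..<2 * m}" "finite X" by (auto simp: X_def)
    then have "card X = card (f ` X)" using 2(1) by (metis card_image inj_on_subset)
    also have "\<dots> \<le> card {2 * n - 1..<N}" by (intro card_mono) (auto simp: X_def)
    also have "\<dots> \<le> (m - 1) div 2" using assms by simp
    finally have X: "card X \<le> (m - 1) div 2" .
    \<comment> \<open>Each edge of the blue cycle has a vertex in \<open>X\<close>, and each vertex
      accounts for at most two edges, so \<open>m \<le> 2 * card X \<le> m - 1\<close>.\<close>
    have "{..<m} \<subseteq> (\<Union>x\<in>X. {x div 2, (x div 2 + (m - 1)) mod m})"
    proof
      fix i assume i: "i \<in> {..<m}"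
      then obtain x where x: "x \<in> cycle_edge m i" "f x \<notin> {..<2 * n - 1}" using 2(3) by auto
      have "x < 2 * m" using x(1) assms by (auto simp: cycle_edge_def)
      then have "x \<in> X" using x(2) 2(2) by (auto simp: X_def)
      then show "i \<in> (\<Union>x\<in>X. {x div 2, (x div 2 + (m - 1)) mod m})"
        using cycle_edge_vertex[of m i x] x(1) i assms by auto
    qed
    then have "card {..<m} \<le> card (\<Union>x\<in>X. {x div 2, (x div 2 + (m - 1)) mod m})"
      using \<open>finite X\<close> by (intro card_mono) auto
    also have "\<dots> \<le> (\<Sum>x\<in>X. card {x div 2, (x div 2 + (m - 1)) mod m})"
      by (rule card_UN_le[OF \<open>finite X\<close>])
    also have "\<dots> \<le> (\<Sum>x\<in>X. 2)" by (intro sum_mono) (simp add: card_insert_if)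
    finally show False using X assms by simp
  qed
qed

theorem theorem3p3:
  fixes n m :: nat
  assumes "n \<ge> m" and "m \<ge> 3"
  shows "ramsey_number3 (loose_cycle n) (loose_cycle m) = 2 * n + (m - 1) div 2"
  unfolding ramsey_number3_def
  by (rule Least_equality) (use assms arrows3_upper not_arrows3_lower not_le in blast)+

end
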